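(* Let $\phi:S^n\to\mathbb{R}$ be bounded and continuous. Then: (i) there is a unique measure $\nu$ maximizing $\operatorname{Gibbs}(\phi,\nu)$ under the constraint $\nu\in\bigcap_{j=1}^n\mathcal{R}_j$; (ii) there is a unique element $\mathbf{m}\in\Delta$ at which the infimum $\inf_{\mathbf{m}'\in\Delta}\operatorname{Parisi}(\mathbf{m}',\phi)$ is attained, and the maximizing measure in (i) is $\nu=G_{\phi,\mathbf{m}}$ for this $\mathbf{m}$; (iii) for this $\mathbf{m}$, $$\operatorname{Gibbs}(\phi,G_{\phi,\mathbf{m}})=\operatorname{Parisi}(\mathbf{m},\phi).$$
   Context: Let $S$ be a Polish space with its Borel $\sigma$-field, let $n\in\mathbb{N}$ be fixed, and let $\mu_1,\dots,\mu_n$ be Borel probability measures on $S$; put $\mu=\mu_1\otimes\cdots\otimes\mu_n$. Let $\gamma_1,\dots,\gamma_n>0$ with $\sum_{k=1}^n\gamma_k=1$, and $\Gamma_j=\sum_{k=1}^j\gamma_k$. $\mathcal{M}_1^+(S^n)$ is the set of Borel probability measures on $S^n$. $H(\nu\mid\mu)$ is the relative entropy: $\int\log\frac{d\nu}{d\mu}\,d\nu$ if $\nu\ll\mu$, and $\infty$ otherwise. For $\nu\in\mathcal{M}_1^+(S^n)$, $\nu^{(j)}$ denotes its marginal on the first $j$ coordinates (so $\mu^{(j)}=\mu_1\otimes\cdots\otimes\mu_j$), $$\mathcal{R}_j=\left\{\nu\in\mathcal{M}_1^+(S^n): H(\nu^{(j)}\mid\mu^{(j)})\le\Gamma_j\log2\right\},$$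 and $\operatorname{Gibbs}(\phi,\nu)=\int\phi\,d\nu-H(\nu\mid\mu)$. $\Delta$ is the set of sequences $\mathbf{m}=(m_1,\dots,m_n)$ with $0<m_1\le m_2\le\cdots\le m_n\le1$. For $\mathbf{m}\in\Delta$ and bounded measurable $\phi:S^n\to\mathbb{R}$ define recursively $\phi_j:S^j\to\mathbb{R}$, $0\le j\le n$, by $\phi_n=\phi$ and $$\phi_{j-1}(x_1,\dots,x_{j-1})=\frac1{m_j}\log\int\exp\left[m_j\phi_j(x_1,\dots,x_{j-1},x_j)\right]\mu_j(dx_j),\qquad 1\le j\le n.$$ $\phi_0$ is a real number, denoted $\phi_0(\mathbf{m})$. Put $$\operatorname{Parisi}(\mathbf{m},\phi)=\sum_{i=1}^n\frac{\gamma_i\log2}{m_i}+\phi_0(\mathbf{m})-\log2.$$ $G_{\phi,\mathbf{m}}$ is the probability measure on $S^n$ given by the semi-direct product $G_{\phi,\mathbf{m}}=\gamma\otimes K_2\otimes\cdots\otimes K_n$, where $\gamma$ is the probability measure on $S$ $$\gamma(dx)=\frac{\exp[m_1\phi_1(x)]\,\mu_1(dx)}{\exp[m_1\phi_0]},$$ and, for $2\le j\le n$, $K_j$ is the Markov kernel from $S^{j-1}$ to $S$ $$K_j(\mathbf{x}^{(j-1)},dx_j)=\frac{\exp[m_j\phi_j(\mathbf{x}^{(j)})]\,\mu_j(dx_j)}{\exp[m_j\phi_{j-1}(\mathbf{x}^{(j-1)})]},\qquad \mathbf{x}^{(j)}=(x_1,\dots,x_j).$$ *)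

theory Defs
  imports "HOL-Probability.Probability"
begin

text \<open>Points of \<open>S\<^sup>j\<close> are functions on \<^term>\<open>{1..j}\<close>, equal to \<^term>\<open>undefined\<close>
  elsewhere; \<open>S\<^sup>0\<close> is the singleton of \<^term>\<open>\<lambda>_. undefined\<close>. As \<open>S\<close> is second countable, the
  product \<open>\<sigma>\<close>-algebra on \<open>S\<^sup>j\<close> is its Borel \<open>\<sigma>\<close>-algebra.\<close>

abbreviation borel_power :: "nat \<Rightarrow> (nat \<Rightarrow> 'a::topological_space) measure" where
  "borel_power j \<equiv> (\<Pi>\<^sub>M i\<in>{1..j}. borel)"

definition prob_measures :: "nat \<Rightarrow> (nat \<Rightarrow> 'a::topological_space) measure set" where
  "prob_measures n = {\<nu>. prob_space \<nu> \<and> sets \<nu> = sets (borel_power n)}"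

text \<open>For probability measures \<open>\<nu> \<ll> \<mu>\<close> the negative part of \<open>log (d\<nu>/d\<mu>)\<close> is always
  \<open>\<nu>\<close>-integrable, so its integral is \<open>\<infinity>\<close> exactly when it is not integrable;
  see \<open>rel_entropy_eq\<close> below.\<close>

definition rel_entropy :: "'b measure \<Rightarrow> 'b measure \<Rightarrow> ereal" where
  "rel_entropy \<nu> \<mu> =
    (if absolutely_continuous \<mu> \<nu> \<and> integrable \<nu> (entropy_density (exp 1) \<mu> \<nu>)
     then ereal (KL_divergence (exp 1) \<mu> \<nu>) else \<infinity>)"

lemma rel_entropy_neg_part:
  assumes "prob_space \<mu>" "prob_space \<nu>" "sets \<nu> = sets \<mu>" "absolutely_continuous \<mu> \<nu>"
  shows "(\<integral>\<^sup>+x. ennreal (- entropy_density (exp 1) \<mu> \<nu> x) \<partial>\<nu>) \<le> 1"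
proof -
  interpret M: prob_space \<mu> by fact
  interpret N: prob_space \<nu> by fact
  let ?D = "RN_deriv \<mu> \<nu>"
  have D: "density \<mu> ?D = \<nu>"
    using M.density_RN_deriv assms by blast
  have fin: "AE x in \<mu>. ?D x \<noteq> \<infinity>"
    by (rule M.RN_deriv_finite)
       (use assms N.sigma_finite_measure_axioms in auto)
  have "(\<integral>\<^sup>+x. ennreal (- entropy_density (exp 1) \<mu> \<nu> x) \<partial>\<nu>)
      = (\<integral>\<^sup>+x. ?D x * ennreal (- entropy_density (exp 1) \<mu> \<nu> x) \<partial>\<mu>)"
  proof -
    have "(\<integral>\<^sup>+x. g x \<partial>\<nu>) = (\<integral>\<^sup>+x. ?D x * g x \<partial>\<mu>)" if "g \<in> borel_measurable \<mu>" for g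
      using nn_integral_density[of ?D \<mu> g] that by (simp add: D)
    then show ?thesis by simp
  qed
  also have "\<dots> \<le> (\<integral>\<^sup>+x. 1 \<partial>\<mu>)"
  proof (rule nn_integral_mono_AE, use fin in eventually_elim)
    fix x assume "?D x \<noteq> \<infinity>"
    then obtain r where r: "r \<ge> 0" "?D x = ennreal r"
      by (cases "?D x") auto
    have "r * (- ln r) \<le> 1"
    proof (cases "r > 0")
      case True
      have "- ln r = ln (1 / r)" using True by (simp add: ln_div)
      also have "\<dots> \<le> 1 / r - 1" using True by (intro ln_le_minus_one) auto
      finally have "r * (- ln r) \<le> r * (1 / r - 1)" using True by (intro mult_left_mono) auto
      also have "\<dots> = 1 - r" using True by (simp add: field_simps)
      finally show ?thesis using True by simp
    qed (use r in auto)
    then show "?D x * ennreal (- entropy_density (exp 1) \<mu> \<nu> x) \<le> 1"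
      using r by (simp add: entropy_density_def log_def ennreal_mult'[symmetric] del: mult_minus_right)
  qed
  finally show ?thesis by (simp add: M.emeasure_space_1)
qed

lemma rel_entropy_eq:
  assumes "prob_space \<mu>" "prob_space \<nu>" "sets \<nu> = sets \<mu>"
  shows "rel_entropy \<nu> \<mu> =
    (if absolutely_continuous \<mu> \<nu>
     then enn2ereal (\<integral>\<^sup>+x. ennreal (ln (enn2real (RN_deriv \<mu> \<nu> x))) \<partial>\<nu>)
        - enn2ereal (\<integral>\<^sup>+x. ennreal (- ln (enn2real (RN_deriv \<mu> \<nu> x))) \<partial>\<nu>)
     else \<infinity>)"
proof (cases "absolutely_continuous \<mu> \<nu>")
  case ac: True
  let ?f = "entropy_density (exp 1) \<mu> \<nu>"
  let ?p = "\<integral>\<^sup>+x. ennreal (?f x) \<partial>\<nu>"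
  let ?q = "\<integral>\<^sup>+x. ennreal (- ?f x) \<partial>\<nu>"
  have f: "?f x = ln (enn2real (RN_deriv \<mu> \<nu> x))" for x
    by (simp add: entropy_density_def log_def)
  have q: "?q \<noteq> \<infinity>"
    using rel_entropy_neg_part[OF assms ac] by (auto simp: top_unique)
  have [measurable]: "?f \<in> borel_measurable \<nu>"
    using measurable_entropy_density[of "exp 1" \<mu> \<nu>] assms(3) measurable_cong_sets by blast
  have "rel_entropy \<nu> \<mu> = enn2ereal ?p - enn2ereal ?q"
  proof (cases "?p = \<infinity>")
    case True
    then have "\<not> integrable \<nu> ?f"
      by (simp add: real_integrable_def)
    then show ?thesis
      using True q by (cases ?q) (auto simp: rel_entropy_def)
  next
    case False
    then have int: "integrable \<nu> ?f"
      using q by (simp add: real_integrable_def)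
    have "KL_divergence (exp 1) \<mu> \<nu> = enn2real ?p - enn2real ?q"
      unfolding KL_divergence_def by (rule real_lebesgue_integral_def[OF int])
    then show ?thesis
      using int ac False q by (cases ?p; cases ?q) (auto simp: rel_entropy_def)
  qed
  then show ?thesis using ac by (simp add: f)
qed (simp add: rel_entropy_def)

definition marginal :: "nat \<Rightarrow> (nat \<Rightarrow> 'a::topological_space) measure \<Rightarrow> (nat \<Rightarrow> 'a) measure" where
  "marginal j \<nu> = distr \<nu> (borel_power j) (\<lambda>x. restrict x {1..j})"

definition entropy_ball ::
  "nat \<Rightarrow> (nat \<Rightarrow> 'a::topological_space measure) \<Rightarrow> (nat \<Rightarrow> real) \<Rightarrow> nat \<Rightarrow> (nat \<Rightarrow> 'a) measure set" where
  "entropy_ball n \<mu> \<gamma> j = {\<nu> \<in> prob_measures n.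
     rel_entropy (marginal j \<nu>) (marginal j (Pi\<^sub>M {1..n} \<mu>)) \<le> ereal ((\<Sum>k=1..j. \<gamma> k) * ln 2)}"

definition Gibbs ::
  "nat \<Rightarrow> (nat \<Rightarrow> 'a::topological_space measure) \<Rightarrow> ((nat \<Rightarrow> 'a) \<Rightarrow> real) \<Rightarrow> (nat \<Rightarrow> 'a) measure \<Rightarrow> ereal" where
  "Gibbs n \<mu> \<phi> \<nu> = ereal (\<integral>x. \<phi> x \<partial>\<nu>) - rel_entropy \<nu> (Pi\<^sub>M {1..n} \<mu>)"

text \<open>Sequences are extensional functions on \<^term>\<open>{1..n}\<close>, so that uniqueness of \<open>m\<close> does not
  depend on values outside this set.\<close>

definition Delta :: "nat \<Rightarrow> (nat \<Rightarrow> real) set" where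
  "Delta n = {m \<in> {1..n} \<rightarrow>\<^sub>E {0<..1}. mono_on {1..n} m}"

text \<open>\<open>phi_rec n \<mu> m \<phi> j\<close> is \<open>\<phi>\<^sub>j : S\<^sup>j \<rightarrow> \<real>\<close>; the recursion runs downwards from \<open>j = n\<close>.\<close>

function phi_rec ::
  "nat \<Rightarrow> (nat \<Rightarrow> 'a measure) \<Rightarrow> (nat \<Rightarrow> real) \<Rightarrow> ((nat \<Rightarrow> 'a) \<Rightarrow> real) \<Rightarrow> nat \<Rightarrow> (nat \<Rightarrow> 'a) \<Rightarrow> real" where
  "phi_rec n \<mu> m \<phi> j x =
    (if n \<le> j then \<phi> x
     else 1 / m (Suc j) *
       ln (\<integral>y. exp (m (Suc j) * phi_rec n \<mu> m \<phi> (Suc j) (x(Suc j := y))) \<partial>\<mu> (Suc j)))"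
  by pat_completeness auto
termination
  by (relation "Wellfounded.measure (\<lambda>(n, _, _, _, j, _). n - j)") auto

declare phi_rec.simps [simp del]

definition Parisi ::
  "nat \<Rightarrow> (nat \<Rightarrow> 'a measure) \<Rightarrow> (nat \<Rightarrow> real) \<Rightarrow> (nat \<Rightarrow> real) \<Rightarrow> ((nat \<Rightarrow> 'a) \<Rightarrow> real) \<Rightarrow> real" where
  "Parisi n \<mu> \<gamma> m \<phi> =
    (\<Sum>i=1..n. \<gamma> i * ln 2 / m i) + phi_rec n \<mu> m \<phi> 0 (\<lambda>_. undefined) - ln 2"

text \<open>The kernel \<open>K\<^sub>j\<close> from \<open>S\<^sup>j\<^sup>-\<^sup>1\<close> to \<open>S\<close>. For \<open>j = 1\<close> it is evaluated at the single point of \<open>S\<^sup>0\<close>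
  only, where it is the initial law, the measure with \<open>\<mu>\<^sub>1\<close>-density
  \<open>exp (m\<^sub>1 \<phi>\<^sub>1(x)) / exp (m\<^sub>1 \<phi>\<^sub>0)\<close>.\<close>

definition K_kernel ::
  "nat \<Rightarrow> (nat \<Rightarrow> 'a measure) \<Rightarrow> (nat \<Rightarrow> real) \<Rightarrow> ((nat \<Rightarrow> 'a) \<Rightarrow> real) \<Rightarrow> nat \<Rightarrow> (nat \<Rightarrow> 'a) \<Rightarrow> 'a measure" where
  "K_kernel n \<mu> m \<phi> j x = density (\<mu> j)
    (\<lambda>y. ennreal (exp (m j * phi_rec n \<mu> m \<phi> j (x(j := y))) / exp (m j * phi_rec n \<mu> m \<phi> (j - 1) x)))"

text \<open>\<open>semidirect K j\<close> is the law on \<open>S\<^sup>j\<close> of \<open>(x\<^sub>1, \<dots>, x\<^sub>j)\<close> when each \<open>x\<^sub>i\<close> is drawn from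
  \<open>K i\<close> given \<open>x\<^sub>1, \<dots>, x\<^sub>i\<^sub>-\<^sub>1\<close>.\<close>

primrec semidirect ::
  "(nat \<Rightarrow> (nat \<Rightarrow> 'a::topological_space) \<Rightarrow> 'a measure) \<Rightarrow> nat \<Rightarrow> (nat \<Rightarrow> 'a) measure" where
  "semidirect K 0 = return (borel_power 0) (\<lambda>_. undefined)"
| "semidirect K (Suc j) =
    semidirect K j \<bind> (\<lambda>x. distr (K (Suc j) x) (borel_power (Suc j)) (\<lambda>y. x(Suc j := y)))"

definition G_measure ::
  "nat \<Rightarrow> (nat \<Rightarrow> 'a::topological_space measure) \<Rightarrow> ((nat \<Rightarrow> 'a) \<Rightarrow> real) \<Rightarrow> (nat \<Rightarrow> real) \<Rightarrow> (nat \<Rightarrow> 'a) measure" where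
  "G_measure n \<mu> \<phi> m = semidirect (K_kernel n \<mu> m \<phi>) n"

end

theory Submission
  imports Defs
begin

text \<open>Write \<open>t\<^sub>j = 1 / m\<^sub>j\<close> with \<open>t\<^sub>n\<^sub>+\<^sub>1 = 1\<close>, and let \<open>W\<^sub>j = \<Sum>\<^sub>i\<^sub>\<le>\<^sub>j m\<^sub>i (\<phi>\<^sub>i - \<phi>\<^sub>i\<^sub>-\<^sub>1)\<close>, the logarithm of the
  density of the \<open>j\<close>-th marginal of \<open>G\<close>. Summation by parts gives
  \<open>\<phi> = \<phi>\<^sub>0 + \<Sum>\<^sub>j (t\<^sub>j - t\<^sub>j\<^sub>+\<^sub>1) W\<^sub>j + W\<^sub>n\<close>. As \<open>\<integral> W\<^sub>j d\<nu> \<le> H(\<nu>\<^sup>(\<^sup>j\<^sup>) | \<mu>\<^sup>(\<^sup>j\<^sup>))\<close> with equality only for the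
  marginal of \<open>G\<close>, every feasible \<open>\<nu>\<close> has \<open>Gibbs(\<phi>, \<nu>) \<le> Parisi(m, \<phi>)\<close>, with equality only for
  \<open>\<nu> = G\<close>. A minimiser of \<open>Parisi\<close> exists by compactness. Perturbing \<open>t\<^sub>1, \<dots>, t\<^sub>j\<close> by a common constant
  shows that at a minimiser \<open>G\<close> is feasible, with the \<open>j\<close>-th entropy constraint active whenever
  \<open>t\<^sub>j > t\<^sub>j\<^sub>+\<^sub>1\<close>; hence equality holds. Two minimisers have the same \<open>G\<close>. At the largest index \<open>j\<close>
  where they differ, \<open>\<phi>\<^sub>j\<close> does not depend on \<open>x\<^sub>j\<close>, so the \<open>j\<close>-th entropy increment vanishes, the
  constraint is inactive and \<open>t\<^sub>j = t\<^sub>j\<^sub>+\<^sub>1\<close> for both, a contradiction.\<close>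

section \<open>Relative entropy\<close>

text \<open>Radon-Nikodym derivatives are unique almost everywhere, so \<open>ln (f x)\<close> may
  replace the entropy density; integrability then passes from \<open>density P f\<close> to
  \<open>P\<close> with weight \<open>f\<close>.\<close>

lemma rel_entropy_density:
  fixes f :: "'b \<Rightarrow> real"
  assumes "prob_space P" and f[measurable]: "f \<in> borel_measurable P"
    and nn: "\<And>x. x \<in> space P \<Longrightarrow> 0 \<le> f x"
  shows "rel_entropy (density P f) P =
    (if integrable P (\<lambda>x. f x * ln (f x)) then ereal (\<integral>x. f x * ln (f x) \<partial>P) else \<infinity>)"
proof -
  interpret prob_space P by fact
  let ?N = "density P f"
  have "AE x in P. f x = RN_deriv P ?N x"
    by (rule RN_deriv_unique) auto
  then have eq: "AE x in P. entropy_density (exp 1) P ?N x = ln (f x)"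
    using AE_space
  proof eventually_elim
    case (elim x)
    then have "enn2real (RN_deriv P ?N x) = f x"
      using nn by (metis enn2real_ennreal)
    then show ?case by (simp add: entropy_density_def log_def)
  qed
  have [measurable]: "entropy_density (exp 1) P ?N \<in> borel_measurable P"
    using measurable_entropy_density by blast
  have ac: "absolutely_continuous P ?N"
    by (rule absolutely_continuousI_density) simp
  have "integrable ?N (entropy_density (exp 1) P ?N) \<longleftrightarrow>
      integrable P (\<lambda>x. f x * entropy_density (exp 1) P ?N x)"
    by (subst integrable_real_density) (use nn in auto)
  also have "\<dots> \<longleftrightarrow> integrable P (\<lambda>x. f x * ln (f x))"
    by (intro integrable_cong_AE) (use eq in auto)
  finally have int: "integrable ?N (entropy_density (exp 1) P ?N) \<longleftrightarrow> integrable P (\<lambda>x. f x * ln (f x))" .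
  have "KL_divergence (exp 1) P ?N = (\<integral>x. f x * ln (f x) \<partial>P)"
    by (subst KL_density) (use nn in \<open>auto simp: log_def\<close>)
  with int ac show ?thesis
    by (simp add: rel_entropy_def)
qed

text \<open>Finite entropy forces absolute continuity, and the derivative is finite almost
  everywhere because \<open>\<nu>\<close> is sigma-finite; so it has a real-valued version.\<close>

lemma rel_entropy_finite_imp_density:
  assumes "prob_space P" "prob_space \<nu>" "sets \<nu> = sets P" "rel_entropy \<nu> P \<noteq> \<infinity>"
  obtains f :: "'b \<Rightarrow> real" where "f \<in> borel_measurable P" "\<And>x. 0 \<le> f x" "\<nu> = density P f"
proof -
  interpret prob_space P by fact
  interpret N: prob_space \<nu> by fact
  have ac: "absolutely_continuous P \<nu>"
    using assms by (auto simp: rel_entropy_def split: if_splits)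
  have fin: "AE x in P. RN_deriv P \<nu> x \<noteq> \<infinity>"
    by (rule RN_deriv_finite) (use ac assms N.sigma_finite_measure_axioms in auto)
  have "\<nu> = density P (RN_deriv P \<nu>)"
    using density_RN_deriv[OF ac assms(3)] by simp
  also have "\<dots> = density P (\<lambda>x. ennreal (enn2real (RN_deriv P \<nu> x)))"
    by (rule density_cong) (use fin in \<open>auto simp: less_top\<close>)
  finally show ?thesis
    using that[of "\<lambda>x. enn2real (RN_deriv P \<nu> x)"] by simp
qed

text \<open>Young's inequality, the pointwise source of the variational bound. For
  \<open>a > 0\<close> it is \<open>ln z \<le> z - 1\<close> at \<open>z = exp w / a\<close>, where
  equality holds only at \<open>z = 1\<close>.\<close>

lemma mult_ln_gap:
  fixes a w :: real
  assumes "a \<ge> 0"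
  shows "a * ln a - a * w - a + exp w \<ge> 0"
    and "a * ln a - a * w - a + exp w = 0 \<Longrightarrow> a = exp w"
proof -
  have "a * ln a - a * w - a + exp w \<ge> 0 \<and> (a * ln a - a * w - a + exp w = 0 \<longrightarrow> a = exp w)"
  proof (cases "a = 0")
    case False
    then have a: "a > 0" using assms by simp
    have eq: "a * ln a - a * w - a + exp w = a * (exp w / a - 1 - ln (exp w / a))"
      using a by (simp add: ln_div field_simps)
    have "ln (exp w / a) \<le> exp w / a - 1"
      using a by (intro ln_le_minus_one) auto
    moreover have "ln (exp w / a) = exp w / a - 1 \<Longrightarrow> exp w / a = 1"
      using a by (intro ln_eq_minus_one) auto
    ultimately show ?thesis
      unfolding eq using a by (auto simp: zero_le_mult_iff dest: sym)
  qed auto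
  then show "a * ln a - a * w - a + exp w \<ge> 0"
    "a * ln a - a * w - a + exp w = 0 \<Longrightarrow> a = exp w" by auto
qed

text \<open>The Donsker-Varadhan bound for a normalised \<open>exp w\<close>. With \<open>f\<close>
  the density of \<open>\<nu>\<close>, the gap of \<open>mult_ln_gap\<close> at
  \<open>a = f x\<close> is integrated: \<open>f\<close> and \<open>exp w\<close> both have integral
  1 and cancel, and equality makes a non-negative integrand vanish almost everywhere.\<close>

lemma rel_entropy_variational:
  fixes w :: "'b \<Rightarrow> real"
  assumes P: "prob_space P" and nu: "prob_space \<nu>" "sets \<nu> = sets P"
    and w[measurable]: "w \<in> borel_measurable P" and bd: "\<And>x. x \<in> space P \<Longrightarrow> \<bar>w x\<bar> \<le> C"
    and norm: "(\<integral>\<^sup>+x. ennreal (exp (w x)) \<partial>P) = 1"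
  shows "ereal (\<integral>x. w x \<partial>\<nu>) \<le> rel_entropy \<nu> P"
    and "rel_entropy \<nu> P = ereal (\<integral>x. w x \<partial>\<nu>) \<Longrightarrow> \<nu> = density P (\<lambda>x. ennreal (exp (w x)))"
proof -
  interpret prob_space P by fact
  have "ereal (\<integral>x. w x \<partial>\<nu>) \<le> rel_entropy \<nu> P \<and>
    (rel_entropy \<nu> P = ereal (\<integral>x. w x \<partial>\<nu>) \<longrightarrow> \<nu> = density P (\<lambda>x. ennreal (exp (w x))))"
  proof (cases "rel_entropy \<nu> P = \<infinity>")
    case False
    obtain f :: "'b \<Rightarrow> real" where f[measurable]: "f \<in> borel_measurable P"
      and f0: "\<And>x. 0 \<le> f x" and nuf: "\<nu> = density P f"
      using rel_entropy_finite_imp_density[OF P nu False] by blast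
    have intl: "integrable P (\<lambda>x. f x * ln (f x))"
      and H: "rel_entropy \<nu> P = ereal (\<integral>x. f x * ln (f x) \<partial>P)"
      using False rel_entropy_density[OF P f] f0 unfolding nuf by (auto split: if_splits)
    have "(\<integral>\<^sup>+x. ennreal (f x) \<partial>P) = 1"
      using prob_space.emeasure_space_1[OF nu(1)] unfolding nuf
      by (simp add: emeasure_density cong: nn_integral_cong)
    then have fi: "integrable P f" "(\<integral>x. f x \<partial>P) = 1"
      using nn_integral_eq_integrable[of f P 1] f0 by auto
    have ei: "integrable P (\<lambda>x. exp (w x))" "(\<integral>x. exp (w x) \<partial>P) = 1"
      using nn_integral_eq_integrable[of "\<lambda>x. exp (w x)" P 1] norm by auto
    have fw: "integrable P (\<lambda>x. f x * w x)"
    proof (rule Bochner_Integration.integrable_bound)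
      show "integrable P (\<lambda>x. f x * C)" using fi by simp
      have "norm (f x * w x) \<le> norm (f x * C)" if "x \<in> space P" for x
        using bd[OF that] f0[of x] by (simp add: abs_mult mult_left_mono)
      then show "AE x in P. norm (f x * w x) \<le> norm (f x * C)" by simp
    qed simp
    have wnu: "(\<integral>x. w x \<partial>\<nu>) = (\<integral>x. f x * w x \<partial>P)"
      unfolding nuf by (subst integral_real_density) (use f0 in auto)
    let ?g = "\<lambda>x. f x * ln (f x) - f x * w x - f x + exp (w x)"
    have gi: "integrable P ?g" using intl fw fi ei by auto
    have gv: "(\<integral>x. ?g x \<partial>P) = (\<integral>x. f x * ln (f x) \<partial>P) - (\<integral>x. w x \<partial>\<nu>)"
      using intl fw fi ei wnu by simp
    have g0: "?g x \<ge> 0" for x by (rule mult_ln_gap) fact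
    have "(\<integral>x. ?g x \<partial>P) \<ge> 0" using g0 by (intro integral_nonneg_AE) auto
    moreover have "\<nu> = density P (\<lambda>x. ennreal (exp (w x)))" if "(\<integral>x. ?g x \<partial>P) = 0"
    proof -
      have "AE x in P. ?g x = 0"
        using integral_nonneg_eq_0_iff_AE[OF gi] g0 that by auto
      then have "AE x in P. f x = exp (w x)"
        by eventually_elim (use mult_ln_gap(2)[OF f0] in blast)
      then show ?thesis unfolding nuf by (intro density_cong) auto
    qed
    ultimately show ?thesis using gv H by auto
  qed auto
  then show "ereal (\<integral>x. w x \<partial>\<nu>) \<le> rel_entropy \<nu> P"
    "rel_entropy \<nu> P = ereal (\<integral>x. w x \<partial>\<nu>) \<Longrightarrow> \<nu> = density P (\<lambda>x. ennreal (exp (w x)))"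
    by auto
qed

text \<open>Supplies the equality case of the variational bound: the test function is the
  log-density itself, and its boundedness keeps the entropy finite.\<close>

lemma rel_entropy_density_exp:
  fixes w :: "'b \<Rightarrow> real"
  assumes P: "prob_space P"
    and w[measurable]: "w \<in> borel_measurable P" and bd: "\<And>x. x \<in> space P \<Longrightarrow> \<bar>w x\<bar> \<le> C"
  defines "\<nu> \<equiv> density P (\<lambda>x. ennreal (exp (w x)))"
  shows "rel_entropy \<nu> P = ereal (\<integral>x. w x \<partial>\<nu>)"
proof -
  interpret prob_space P by fact
  have "integrable P (\<lambda>x. exp (w x) * w x)"
  proof (rule integrable_const_bound)
    have "norm (exp (w x) * w x) \<le> exp C * C" if "x \<in> space P" for x
      using bd[OF that] by (auto simp: abs_mult intro!: mult_mono)
    then show "AE x in P. norm (exp (w x) * w x) \<le> exp C * C" by simp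
  qed simp
  moreover have "(\<integral>x. w x \<partial>\<nu>) = (\<integral>x. exp (w x) * w x \<partial>P)"
    unfolding \<nu>_def by (subst integral_real_density) auto
  ultimately show ?thesis
    unfolding \<nu>_def by (subst rel_entropy_density[OF P]) auto
qed

section \<open>The recursion and its Gibbs measure\<close>

text \<open>Every \<open>\<mu> j\<close> is a probability measure here, also for \<open>j\<close>
  outside \<open>{1..n}\<close>, so that \<open>product_prob_space\<close> is available over
  \<open>UNIV\<close>. The last section reduces the theorem to this situation.\<close>

locale cascade =
  fixes n :: nat
    and \<mu> :: "nat \<Rightarrow> 'a::topological_space measure"
    and \<phi> :: "(nat \<Rightarrow> 'a) \<Rightarrow> real"
    and B :: real
  assumes prob_mu: "prob_space (\<mu> j)"
    and sets_mu: "sets (\<mu> j) = sets borel"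
    and meas_phi: "\<phi> \<in> borel_measurable (Pi\<^sub>M {1..n} \<mu>)"
    and bound_phi: "x \<in> space (Pi\<^sub>M {1..n} \<mu>) \<Longrightarrow> \<bar>\<phi> x\<bar> \<le> B"
begin

declare One_nat_def [simp del]

sublocale product_prob_space \<mu> UNIV
  by (intro product_prob_spaceI prob_mu)

abbreviation P :: "nat \<Rightarrow> (nat \<Rightarrow> 'a) measure" where
  "P j \<equiv> Pi\<^sub>M {1..j} \<mu>"

abbreviation \<Phi> :: "(nat \<Rightarrow> real) \<Rightarrow> nat \<Rightarrow> (nat \<Rightarrow> 'a) \<Rightarrow> real" where
  "\<Phi> m j \<equiv> phi_rec n \<mu> m \<phi> j"

section \<open>Product spaces: projections and appending a coordinate\<close>

lemma prob_P: "prob_space (P j)"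
  by (rule prob_space_PiM) (rule prob_mu)

lemma sets_P: "sets (P j) = sets (borel_power j)"
  by (rule sets_PiM_cong) (simp_all add: sets_mu)

lemma space_mu: "space (\<mu> j) = UNIV"
  using sets_eq_imp_space_eq[OF sets_mu, of j] by simp

lemma space_P: "space (P j) = {1..j} \<rightarrow>\<^sub>E UNIV"
  by (simp add: space_PiM space_mu)

lemma measurable_restrict_P: "j \<le> k \<Longrightarrow> (\<lambda>x. restrict x {1..j}) \<in> P k \<rightarrow>\<^sub>M P j"
  by (rule measurable_restrict_subset) auto

lemma measurable_upd_P: "(\<lambda>(x, y). x(Suc j := y)) \<in> P j \<Otimes>\<^sub>M \<mu> (Suc j) \<rightarrow>\<^sub>M P (Suc j)"
  using measurable_add_dim[of "Suc j" "{1..j}" \<mu>] by (simp add: atLeastAtMostSuc_conv)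

lemma measurable_upd_P':
  assumes "x \<in> space (P j)"
  shows "(\<lambda>y. x(Suc j := y)) \<in> \<mu> (Suc j) \<rightarrow>\<^sub>M P (Suc j)"
  using measurable_Pair_compose_split[OF measurable_upd_P measurable_const[OF assms] measurable_ident]
  by (simp only: id_apply)

lemma upd_in_space_P: "x \<in> space (P j) \<Longrightarrow> x(Suc j := y) \<in> space (P (Suc j))"
  by (auto simp: space_P PiE_iff extensional_def)

lemma restrict_space_P: "x \<in> space (P j) \<Longrightarrow> restrict x {1..j} = x"
  by (auto simp: space_P PiE_iff extensional_restrict)

lemma restrict_restrict_le: "j \<le> k \<Longrightarrow> restrict (restrict x {1..k}) {1..j} = restrict x {1..j::nat}"
  by (auto simp: restrict_def fun_eq_iff)

lemma restrict_upd_P: "x \<in> space (P j) \<Longrightarrow> restrict (x(Suc j := y)) {1..j} = x"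
  by (auto simp: space_P PiE_iff extensional_def restrict_def fun_eq_iff)

text \<open>Tonelli with the new coordinate innermost; each passage from \<open>P j\<close> to
  \<open>P (Suc j)\<close> below rests on it.\<close>

lemma nn_integral_P_Suc:
  assumes "f \<in> borel_measurable (P (Suc j))"
  shows "integral\<^sup>N (P (Suc j)) f = (\<integral>\<^sup>+x. (\<integral>\<^sup>+y. f (x(Suc j := y)) \<partial>\<mu> (Suc j)) \<partial>P j)"
  using product_nn_integral_insert[of "{1..j}" "Suc j" f] assms
  by (simp add: atLeastAtMostSuc_conv)

lemma marginal_P:
  assumes "1 \<le> j" "j \<le> n"
  shows "marginal j (P n) = P j"
proof -
  have "marginal j (P n) = distr (P n) (P j) (\<lambda>x. restrict x {1..j})"
    unfolding marginal_def by (rule distr_cong) (simp_all add: sets_P)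
  also have "\<dots> = P j"
    by (rule distr_restrict[symmetric]) (use assms in auto)
  finally show ?thesis .
qed

lemma Delta_pos: "m \<in> Delta n \<Longrightarrow> 1 \<le> i \<Longrightarrow> i \<le> n \<Longrightarrow> 0 < m i"
  and Delta_le1: "m \<in> Delta n \<Longrightarrow> 1 \<le> i \<Longrightarrow> i \<le> n \<Longrightarrow> m i \<le> 1"
  by (auto simp: Delta_def PiE_iff)

section \<open>Measurability and uniform bounds for the recursion\<close>

lemma B_nonneg: "0 \<le> B"
proof -
  obtain x where "x \<in> space (P n)"
    using prob_space.not_empty[OF prob_P] by blast
  from bound_phi[OF this] show ?thesis by linarith
qed

lemma phi_rec_n: "\<Phi> m n x = \<phi> x"
  by (simp add: phi_rec.simps)

lemma phi_rec_less:
  "j < n \<Longrightarrow> \<Phi> m j x =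
    1 / m (Suc j) * ln (\<integral>y. exp (m (Suc j) * \<Phi> m (Suc j) (x(Suc j := y))) \<partial>\<mu> (Suc j))"
  by (subst phi_rec.simps) simp

text \<open>Downward induction from \<open>n\<close>: an average of values between
  \<open>exp (- m B)\<close> and \<open>exp (m B)\<close> stays between them, and
  \<open>1 / m * ln\<close> brings it back to \<open>[-B, B]\<close>. The bound is uniform in
  \<open>m\<close>, as dominated convergence and compactness require later.\<close>

lemma phi_rec_measurable_bounded:
  assumes m: "m \<in> Delta n" and "j \<le> n"
  shows "\<Phi> m j \<in> borel_measurable (P j) \<and> (\<forall>x\<in>space (P j). \<bar>\<Phi> m j x\<bar> \<le> B)"
  using \<open>j \<le> n\<close>
proof (induction rule: inc_induct)
  case base
  have "\<Phi> m n = \<phi>" by (simp add: fun_eq_iff phi_rec_n)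
  then show ?case using meas_phi bound_phi by simp
next
  case (step j)
  note [measurable] = conjunct1[OF step.IH] measurable_upd_P
  have bd: "\<bar>\<Phi> m (Suc j) x\<bar> \<le> B" if "x \<in> space (P (Suc j))" for x
    using step.IH that by blast
  let ?m = "m (Suc j)"
  let ?I = "\<lambda>x. \<integral>y. exp (?m * \<Phi> m (Suc j) (x(Suc j := y))) \<partial>\<mu> (Suc j)"
  have mpos: "?m > 0" using Delta_pos[OF m] step by simp
  have "(\<lambda>x. 1 / ?m * ln (?I x)) \<in> borel_measurable (P j)"
  proof -
    have "(\<lambda>(x, y). exp (?m * \<Phi> m (Suc j) (x(Suc j := y)))) \<in> borel_measurable (P j \<Otimes>\<^sub>M \<mu> (Suc j))"
      using measurable_compose[OF measurable_upd_P conjunct1[OF step.IH]] unfolding split_beta' by measurable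
    from M.borel_measurable_lebesgue_integral[OF this]
    show ?thesis by simp
  qed
  moreover have "\<bar>1 / ?m * ln (?I x)\<bar> \<le> B" if x: "x \<in> space (P j)" for x
  proof -
    have [measurable]: "(\<lambda>y. \<Phi> m (Suc j) (x(Suc j := y))) \<in> borel_measurable (\<mu> (Suc j))"
      using measurable_compose[OF measurable_upd_P'[OF x] conjunct1[OF step.IH]] .
    have b: "- B \<le> \<Phi> m (Suc j) (x(Suc j := y))" "\<Phi> m (Suc j) (x(Suc j := y)) \<le> B" for y
      using bd[OF upd_in_space_P[OF x, of y]] by auto
    have int: "integrable (\<mu> (Suc j)) (\<lambda>y. exp (?m * \<Phi> m (Suc j) (x(Suc j := y))))"
      by (rule M.integrable_const_bound[where B="exp (?m * B)"]) (use b mpos in auto)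
    have lb: "?m * (- B) \<le> ?m * \<Phi> m (Suc j) (x(Suc j := y))" for y
      using b mpos by (intro mult_left_mono) auto
    have lo: "exp (?m * (- B)) \<le> ?I x"
      by (rule M.integral_ge_const[OF int]) (use lb in \<open>auto simp del: mult_minus_right\<close>)
    have up: "?I x \<le> exp (?m * B)"
      by (rule M.integral_le_const[OF int]) (use b mpos in auto)
    have pos: "0 < ?I x" using lo exp_gt_zero less_le_trans by blast
    have "?m * (- B) \<le> ln (?I x)" using lo pos by (subst ln_ge_iff) auto
    moreover have "ln (?I x) \<le> ?m * B" using up pos by (metis ln_exp ln_mono)
    ultimately show ?thesis using mpos by (auto simp: abs_le_iff field_simps)
  qed
  ultimately show ?case
    using phi_rec_less[OF step.hyps(2), of m] by (simp add: fun_eq_iff[symmetric, of "\<Phi> m j"] cong: measurable_cong)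
qed

lemmas phi_rec_measurable = conjunct1[OF phi_rec_measurable_bounded]
lemmas phi_rec_bounded = bspec[OF conjunct2[OF phi_rec_measurable_bounded]]

text \<open>The recursion in exponential form. The integral is at least
  \<open>exp (- m B) > 0\<close>, so the logarithm can be inverted. In other words,
  \<open>K_kernel\<close> has total mass 1.\<close>

lemma exp_phi_rec:
  assumes m: "m \<in> Delta n" and j: "Suc j \<le> n" and x: "x \<in> space (P j)"
  shows "(\<integral>\<^sup>+y. ennreal (exp (m (Suc j) * \<Phi> m (Suc j) (x(Suc j := y)))) \<partial>\<mu> (Suc j))
    = ennreal (exp (m (Suc j) * \<Phi> m j x))"
proof -
  let ?m = "m (Suc j)"
  have mpos: "?m > 0" using Delta_pos[OF m] j by simp
  have [measurable]: "(\<lambda>y. \<Phi> m (Suc j) (x(Suc j := y))) \<in> borel_measurable (\<mu> (Suc j))"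
    using measurable_compose[OF measurable_upd_P'[OF x] phi_rec_measurable[OF m j]] .
  have b: "- B \<le> \<Phi> m (Suc j) (x(Suc j := y))" "\<Phi> m (Suc j) (x(Suc j := y)) \<le> B" for y
    using phi_rec_bounded[OF m j upd_in_space_P[OF x, of y]] by auto
  have int: "integrable (\<mu> (Suc j)) (\<lambda>y. exp (?m * \<Phi> m (Suc j) (x(Suc j := y))))"
    by (rule M.integrable_const_bound[where B="exp (?m * B)"]) (use b mpos in auto)
  have lb: "?m * (- B) \<le> ?m * \<Phi> m (Suc j) (x(Suc j := y))" for y
    using b mpos by (intro mult_left_mono) auto
  have "exp (?m * (- B)) \<le> (\<integral>y. exp (?m * \<Phi> m (Suc j) (x(Suc j := y))) \<partial>\<mu> (Suc j))"
    by (rule M.integral_ge_const[OF int]) (use lb in \<open>auto simp del: mult_minus_right\<close>)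
  then have pos: "0 < (\<integral>y. exp (?m * \<Phi> m (Suc j) (x(Suc j := y))) \<partial>\<mu> (Suc j))"
    using exp_gt_zero less_le_trans by blast
  have "(\<integral>\<^sup>+y. ennreal (exp (?m * \<Phi> m (Suc j) (x(Suc j := y)))) \<partial>\<mu> (Suc j))
    = ennreal (\<integral>y. exp (?m * \<Phi> m (Suc j) (x(Suc j := y))) \<partial>\<mu> (Suc j))"
    by (rule nn_integral_eq_integral[OF int]) auto
  also have "(\<integral>y. exp (?m * \<Phi> m (Suc j) (x(Suc j := y))) \<partial>\<mu> (Suc j)) = exp (?m * \<Phi> m j x)"
    using j mpos pos by (subst (2) phi_rec_less) simp_all
  finally show ?thesis .
qed

section \<open>Log-densities and the tilted measures\<close>

text \<open>Each \<open>\<Phi> m i\<close> lives on \<open>{1..i}\<close>, hence the restrictions;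
  with them \<open>W m j\<close> is a function on every \<open>P k\<close> with
  \<open>j \<le> k\<close>.\<close>

definition W :: "(nat \<Rightarrow> real) \<Rightarrow> nat \<Rightarrow> (nat \<Rightarrow> 'a) \<Rightarrow> real" where
  "W m j x = (\<Sum>i=1..j. m i * (\<Phi> m i (restrict x {1..i}) - \<Phi> m (i - 1) (restrict x {1..i - 1})))"

text \<open>An explicit density is easier to handle than iterated kernels;
  \<open>semidirect_eq_G\<close> identifies the two.\<close>

definition G :: "(nat \<Rightarrow> real) \<Rightarrow> nat \<Rightarrow> (nat \<Rightarrow> 'a) measure" where
  "G m j = density (P j) (\<lambda>x. ennreal (exp (W m j x)))"

lemma phi_rec_restrict_measurable:
  assumes "m \<in> Delta n" "i \<le> k" "i \<le> n"
  shows "(\<lambda>x. \<Phi> m i (restrict x {1..i})) \<in> borel_measurable (P k)"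
  using measurable_compose[OF measurable_restrict_P phi_rec_measurable] assms by blast

lemma phi_rec_restrict_bounded:
  assumes "m \<in> Delta n" "i \<le> n"
  shows "\<bar>\<Phi> m i (restrict x {1..i})\<bar> \<le> B"
  by (rule phi_rec_bounded[OF assms]) (simp add: space_P)

lemma W_measurable:
  assumes "m \<in> Delta n" "j \<le> k" "j \<le> n"
  shows "W m j \<in> borel_measurable (P k)"
  unfolding W_def using assms
  by (auto intro!: borel_measurable_sum borel_measurable_times borel_measurable_diff phi_rec_restrict_measurable)

text \<open>At most \<open>n\<close> summands, each of size at most \<open>2 * B\<close> because
  \<open>m i \<le> 1\<close>.\<close>

lemma W_bounded:
  assumes m: "m \<in> Delta n" and "j \<le> n"
  shows "\<bar>W m j x\<bar> \<le> real n * (2 * B)"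
proof -
  have "\<bar>m i * (\<Phi> m i (restrict x {1..i}) - \<Phi> m (i - 1) (restrict x {1..i - 1}))\<bar> \<le> 2 * B"
    if "i \<in> {1..j}" for i
  proof -
    have "i \<le> n" "i - 1 \<le> n" using that \<open>j \<le> n\<close> by auto
    then have "\<bar>\<Phi> m i (restrict x {1..i}) - \<Phi> m (i - 1) (restrict x {1..i - 1})\<bar> \<le> 2 * B"
      using phi_rec_restrict_bounded[OF m, of i x] phi_rec_restrict_bounded[OF m, of "i - 1" x]
        by (simp add: abs_le_iff)
    moreover have "0 < m i" "m i \<le> 1" using that \<open>j \<le> n\<close> Delta_pos[OF m] Delta_le1[OF m] by auto
    ultimately have "\<bar>m i\<bar> * \<bar>\<Phi> m i (restrict x {1..i}) - \<Phi> m (i - 1) (restrict x {1..i - 1})\<bar> \<le> 1 * (2 * B)"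
      by (intro mult_mono) auto
    then show ?thesis by (simp add: abs_mult)
  qed
  then have "\<bar>W m j x\<bar> \<le> (\<Sum>i=1..j. 2 * B)"
    unfolding W_def by (intro order_trans[OF sum_abs] sum_mono)
  also have "\<dots> = real j * (2 * B)" by simp
  also have "\<dots> \<le> real n * (2 * B)" using \<open>j \<le> n\<close> B_nonneg by (intro mult_right_mono) auto
  finally show ?thesis .
qed

lemma W_restrict: "j \<le> k \<Longrightarrow> W m j (restrict x {1..k}) = W m j x"
  unfolding W_def by (intro sum.cong) (auto simp: restrict_restrict_le simp del: restrict_restrict)

lemma W_0 [simp]: "W m 0 x = 0"
  by (simp add: W_def)

lemma W_Suc:
  "W m (Suc j) x = W m j x + m (Suc j) * (\<Phi> m (Suc j) (restrict x {1..Suc j}) - \<Phi> m j (restrict x {1..j}))"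
  by (simp add: W_def)

lemma W_upd:
  assumes x: "x \<in> space (P j)"
  shows "W m (Suc j) (x(Suc j := y)) = W m j x + m (Suc j) * (\<Phi> m (Suc j) (x(Suc j := y)) - \<Phi> m j x)"
proof -
  have "W m j (x(Suc j := y)) = W m j x"
    using W_restrict[of j j m "x(Suc j := y)"] by (simp add: restrict_upd_P[OF x])
  then show ?thesis
    using restrict_space_P[OF upd_in_space_P[OF x, of y]]
    by (simp add: W_Suc restrict_upd_P[OF x])
qed

text \<open>The martingale property of \<open>exp (W m j)\<close> under the product measure: given
  the first \<open>j\<close> coordinates, the new factor integrates to 1 by
  \<open>exp_phi_rec\<close>.\<close>

lemma nn_integral_exp_W_Suc:
  assumes m: "m \<in> Delta n" and j: "Suc j \<le> n" and F[measurable]: "F \<in> borel_measurable (P j)"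
  shows "(\<integral>\<^sup>+x. ennreal (exp (W m (Suc j) x)) * F (restrict x {1..j}) \<partial>P (Suc j))
    = (\<integral>\<^sup>+x. ennreal (exp (W m j x)) * F x \<partial>P j)"
proof -
  note [measurable] = W_measurable[OF m le_refl j]
  have Fr: "(\<lambda>x. F (restrict x {1..j})) \<in> borel_measurable (P (Suc j))"
    by (rule measurable_compose[OF measurable_restrict_P F]) simp
  have "(\<integral>\<^sup>+x. ennreal (exp (W m (Suc j) x)) * F (restrict x {1..j}) \<partial>P (Suc j))
    = (\<integral>\<^sup>+x. \<integral>\<^sup>+y. ennreal (exp (W m (Suc j) (x(Suc j := y)))) * F (restrict (x(Suc j := y)) {1..j}) \<partial>\<mu> (Suc j) \<partial>P j)"
    by (subst nn_integral_P_Suc) (use Fr in measurable)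
  also have "\<dots> = (\<integral>\<^sup>+x. ennreal (exp (W m j x)) * F x \<partial>P j)"
  proof (rule nn_integral_cong)
    fix x assume x: "x \<in> space (P j)"
    \<comment> \<open>The part of \<open>exp (W m (Suc j))\<close> that does not involve the new
      coordinate.\<close>
    let ?c = "exp (W m j x - m (Suc j) * \<Phi> m j x)"
    have [measurable]: "(\<lambda>y. \<Phi> m (Suc j) (x(Suc j := y))) \<in> borel_measurable (\<mu> (Suc j))"
      using measurable_compose[OF measurable_upd_P'[OF x] phi_rec_measurable[OF m j]] .
    have "(\<integral>\<^sup>+y. ennreal (exp (W m (Suc j) (x(Suc j := y)))) * F (restrict (x(Suc j := y)) {1..j}) \<partial>\<mu> (Suc j))
      = (\<integral>\<^sup>+y. (ennreal ?c * F x) * ennreal (exp (m (Suc j) * \<Phi> m (Suc j) (x(Suc j := y)))) \<partial>\<mu> (Suc j))"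
    proof (rule nn_integral_cong)
      fix y
      have "exp (W m (Suc j) (x(Suc j := y))) = ?c * exp (m (Suc j) * \<Phi> m (Suc j) (x(Suc j := y)))"
        unfolding W_upd[OF x] by (simp add: exp_add[symmetric] algebra_simps)
      then show "ennreal (exp (W m (Suc j) (x(Suc j := y)))) * F (restrict (x(Suc j := y)) {1..j})
        = (ennreal ?c * F x) * ennreal (exp (m (Suc j) * \<Phi> m (Suc j) (x(Suc j := y))))"
        by (simp add: restrict_upd_P[OF x] ennreal_mult' mult_ac)
    qed
    also have "\<dots> = (ennreal ?c * F x) * ennreal (exp (m (Suc j) * \<Phi> m j x))"
      by (subst nn_integral_cmult) (simp_all add: exp_phi_rec[OF m j x])
    also have "\<dots> = ennreal (?c * exp (m (Suc j) * \<Phi> m j x)) * F x"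
      by (simp add: ennreal_mult' mult_ac)
    also have "?c * exp (m (Suc j) * \<Phi> m j x) = exp (W m j x)"
      by (simp add: exp_add[symmetric])
    finally show "(\<integral>\<^sup>+y. ennreal (exp (W m (Suc j) (x(Suc j := y)))) * F (restrict (x(Suc j := y)) {1..j}) \<partial>\<mu> (Suc j))
      = ennreal (exp (W m j x)) * F x" .
  qed
  finally show ?thesis .
qed

lemma nn_integral_exp_W:
  assumes m: "m \<in> Delta n" and "j \<le> k" "k \<le> n" and F: "F \<in> borel_measurable (P j)"
  shows "(\<integral>\<^sup>+x. ennreal (exp (W m k x)) * F (restrict x {1..j}) \<partial>P k)
    = (\<integral>\<^sup>+x. ennreal (exp (W m j x)) * F x \<partial>P j)"
  using \<open>j \<le> k\<close> \<open>k \<le> n\<close>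
proof (induction rule: dec_induct)
  case base
  show ?case by (rule nn_integral_cong) (simp only: restrict_space_P)
next
  case (step k)
  have "(\<lambda>x. F (restrict x {1..j})) \<in> borel_measurable (P k)"
    by (rule measurable_compose[OF measurable_restrict_P F]) (use step in simp)
  note nn_integral_exp_W_Suc[OF m step.prems this, unfolded restrict_restrict_le[OF \<open>j \<le> k\<close>]]
  also note step.IH[OF Suc_leD[OF step.prems]]
  finally show ?case .
qed

lemma nn_integral_exp_W_1:
  assumes "m \<in> Delta n" "j \<le> n"
  shows "(\<integral>\<^sup>+x. ennreal (exp (W m j x)) \<partial>P j) = 1"
  using nn_integral_exp_W[OF assms(1) _ assms(2), of 0 "\<lambda>_. 1"] prob_space.emeasure_space_1[OF prob_P, of 0]
  by simp

lemma sets_G [simp]: "sets (G m j) = sets (P j)"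
  and space_G [simp]: "space (G m j) = space (P j)"
  by (simp_all add: G_def)

lemma prob_G:
  assumes m: "m \<in> Delta n" "j \<le> n"
  shows "prob_space (G m j)"
proof
  note [measurable] = W_measurable[OF m(1) le_refl m(2)]
  show "emeasure (G m j) (space (G m j)) = 1"
    unfolding G_def using nn_integral_exp_W_1[OF m]
    by (simp add: emeasure_density cong: nn_integral_cong)
qed

text \<open>The martingale property tested on indicators makes the family \<open>G m j\<close>
  consistent.\<close>

lemma marginal_G:
  assumes m: "m \<in> Delta n" and j: "j \<le> n"
  shows "marginal j (G m n) = G m j"
proof (rule measure_eqI)
  note [measurable] = W_measurable[OF m le_refl le_refl] W_measurable[OF m le_refl j]
  show "sets (marginal j (G m n)) = sets (G m j)"
    by (simp add: marginal_def sets_P)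
  fix A assume "A \<in> sets (marginal j (G m n))"
  then have A[measurable]: "A \<in> sets (P j)" by (simp add: marginal_def sets_P)
  have r: "(\<lambda>x. restrict x {1..j}) \<in> P n \<rightarrow>\<^sub>M P j" by (rule measurable_restrict_P[OF j])
  have "emeasure (marginal j (G m n)) A = emeasure (G m n) ((\<lambda>x. restrict x {1..j}) -` A \<inter> space (P n))"
    unfolding marginal_def
    by (subst emeasure_distr) (use A r in \<open>simp_all add: sets_P[symmetric] cong: measurable_cong_sets\<close>)
  also have "\<dots> = (\<integral>\<^sup>+x. ennreal (exp (W m n x)) * indicator A (restrict x {1..j}) \<partial>P n)"
    unfolding G_def
    by (subst emeasure_density) (use measurable_sets[OF r A] in \<open>auto intro!: nn_integral_cong split: split_indicator\<close>)
  also have "\<dots> = emeasure (G m j) A"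
    unfolding G_def by (subst nn_integral_exp_W[OF m j le_refl]) (simp_all add: emeasure_density)
  finally show "emeasure (marginal j (G m n)) A = emeasure (G m j) A" .
qed

text \<open>Induction on \<open>j\<close>: the log-density of the kernel at \<open>Suc j\<close> is
  the last increment of \<open>W\<close>, so binding it to \<open>G m j\<close> adds this increment
  in the exponent.\<close>

lemma semidirect_eq_G:
  assumes m: "m \<in> Delta n" and "j \<le> n"
  shows "semidirect (K_kernel n \<mu> m \<phi>) j = G m j"
  using \<open>j \<le> n\<close>
proof (induction j)
  case 0
  show ?case
  proof (rule measure_eqI)
    show s: "sets (semidirect (K_kernel n \<mu> m \<phi>) 0) = sets (G m 0)" by (simp add: PiM_empty)
    fix A assume A: "A \<in> sets (semidirect (K_kernel n \<mu> m \<phi>) 0)"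
    show "emeasure (semidirect (K_kernel n \<mu> m \<phi>) 0) A = emeasure (G m 0) A"
      using A by (auto simp: G_def PiM_empty density_1 emeasure_return emeasure_count_space
          dest!: subset_singletonD split: split_indicator)
  qed
next
  case (Suc j)
  let ?K = "K_kernel n \<mu> m \<phi>"
  let ?k = "\<lambda>x. distr (?K (Suc j) x) (borel_power (Suc j)) (\<lambda>y. x(Suc j := y))"
  have j: "j \<le> n" "Suc j \<le> n" using Suc.prems by auto
  note [measurable] = W_measurable[OF m le_refl j(1)] W_measurable[OF m le_refl j(2)]
    phi_rec_measurable[OF m j(1)] phi_rec_measurable[OF m j(2)] measurable_upd_P
  have [measurable]: "(\<lambda>y. \<Phi> m (Suc j) (x(Suc j := y))) \<in> borel_measurable (\<mu> (Suc j))"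
    if "x \<in> space (P j)" for x
    using measurable_compose[OF measurable_upd_P'[OF that] phi_rec_measurable[OF m j(2)]] .
  let ?w = "\<lambda>x y. m (Suc j) * (\<Phi> m (Suc j) (x(Suc j := y)) - \<Phi> m j x)"
  have Kd: "?K (Suc j) x = density (\<mu> (Suc j)) (\<lambda>y. ennreal (exp (?w x y)))" for x
    unfolding K_kernel_def by (simp add: exp_diff right_diff_distrib)
  have k: "emeasure (?k x) A = (\<integral>\<^sup>+y. ennreal (exp (?w x y)) * indicator A (x(Suc j := y)) \<partial>\<mu> (Suc j))"
    if x: "x \<in> space (P j)" and A: "A \<in> sets (P (Suc j))" for x A
  proof -
    have u: "(\<lambda>y. x(Suc j := y)) \<in> \<mu> (Suc j) \<rightarrow>\<^sub>M P (Suc j)" by (rule measurable_upd_P'[OF x])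
    have "emeasure (?k x) A = emeasure (?K (Suc j) x) ((\<lambda>y. x(Suc j := y)) -` A \<inter> space (\<mu> (Suc j)))"
      unfolding Kd
      by (subst emeasure_distr) (use A u in \<open>simp_all add: sets_P[symmetric] cong: measurable_cong_sets\<close>)
    also have "\<dots> = (\<integral>\<^sup>+y. ennreal (exp (?w x y)) * indicator A (x(Suc j := y)) \<partial>\<mu> (Suc j))"
      unfolding Kd
      by (subst emeasure_density)
        (use measurable_sets[OF u A] x in \<open>auto intro!: nn_integral_cong split: split_indicator\<close>)
    finally show ?thesis .
  qed
  \<comment> \<open>Joint measurability in \<open>(x, y)\<close> yields measurability of the kernel
    in \<open>x\<close>.\<close>
  have joint: "(\<lambda>(x, y). ennreal (exp (?w x y)) * indicator A (x(Suc j := y))) \<in> borel_measurable (P j \<Otimes>\<^sub>M \<mu> (Suc j))"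
    if A: "A \<in> sets (P (Suc j))" for A
  proof -
    have 1: "(\<lambda>z. \<Phi> m (Suc j) ((fst z)(Suc j := snd z))) \<in> borel_measurable (P j \<Otimes>\<^sub>M \<mu> (Suc j))"
      using measurable_compose[OF measurable_upd_P phi_rec_measurable[OF m j(2)]] unfolding split_beta' .
    have 2: "(\<lambda>z. indicator A ((fst z)(Suc j := snd z)) :: ennreal) \<in> borel_measurable (P j \<Otimes>\<^sub>M \<mu> (Suc j))"
      using measurable_compose[OF measurable_upd_P borel_measurable_indicator[OF A]] unfolding split_beta' .
    show ?thesis unfolding split_beta' using 1 2 by measurable
  qed
  have one: "(\<integral>\<^sup>+y. ennreal (exp (?w x y)) \<partial>\<mu> (Suc j)) = 1" if x: "x \<in> space (P j)" for x
  proof -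
    have "(\<integral>\<^sup>+y. ennreal (exp (?w x y)) \<partial>\<mu> (Suc j))
      = (\<integral>\<^sup>+y. ennreal (exp (- m (Suc j) * \<Phi> m j x)) * ennreal (exp (m (Suc j) * \<Phi> m (Suc j) (x(Suc j := y)))) \<partial>\<mu> (Suc j))"
      by (simp add: ennreal_mult'[symmetric] exp_add[symmetric] algebra_simps)
    also have "\<dots> = ennreal (exp (- m (Suc j) * \<Phi> m j x)) * ennreal (exp (m (Suc j) * \<Phi> m j x))"
      by (subst nn_integral_cmult) (use x in \<open>simp_all add: exp_phi_rec[OF m j(2) x]\<close>)
    also have "\<dots> = 1" by (simp add: ennreal_mult'[symmetric] exp_add[symmetric])
    finally show ?thesis .
  qed
  \<comment> \<open>\<open>emeasure_bind\<close> can be applied only to a measurable kernel into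
    subprobability measures.\<close>
  have kmeas: "?k \<in> G m j \<rightarrow>\<^sub>M subprob_algebra (borel_power (Suc j))"
  proof (rule measurable_subprob_algebra)
    fix x assume "x \<in> space (G m j)"
    then have x: "x \<in> space (P j)" by simp
    have "emeasure (?K (Suc j) x) (space (\<mu> (Suc j))) = 1"
      unfolding Kd using x one[OF x] by (subst emeasure_density) (simp_all cong: nn_integral_cong)
    then have "prob_space (?K (Suc j) x)"
      by (intro prob_spaceI) (simp add: Kd)
    then show "subprob_space (?k x)"
      using measurable_upd_P'[OF x]
      by (intro prob_space_imp_subprob_space prob_space.prob_space_distr)
        (simp_all add: Kd sets_P[symmetric] cong: measurable_cong_sets)
  next
    fix A :: "(nat \<Rightarrow> 'a) set" assume "A \<in> sets (borel_power (Suc j))"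
    then have A: "A \<in> sets (P (Suc j))" by (simp add: sets_P)
      have "(\<lambda>x. emeasure (?k x) A) \<in> borel_measurable (P j)"
      using M.borel_measurable_nn_integral[OF joint[OF A]]
      by (rule measurable_cong[THEN iffD2, rotated]) (simp add: k A)
    then show "(\<lambda>x. emeasure (?k x) A) \<in> borel_measurable (G m j)"
      by (simp add: G_def)
  qed simp
  have ne: "space (G m j) \<noteq> {}" using prob_space.not_empty[OF prob_P] by simp
  show ?case
  proof (rule measure_eqI)
    show s: "sets (semidirect ?K (Suc j)) = sets (G m (Suc j))"
      using ne by (simp add: Suc.IH j sets_P)
    fix A assume "A \<in> sets (semidirect ?K (Suc j))"
    then have A[measurable]: "A \<in> sets (P (Suc j))" using s by simp
    have "emeasure (semidirect ?K (Suc j)) A = (\<integral>\<^sup>+x. emeasure (?k x) A \<partial>G m j)"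
      using A emeasure_bind[OF ne kmeas, of A] by (simp add: Suc.IH j sets_P)
    also have "\<dots> = (\<integral>\<^sup>+x. ennreal (exp (W m j x)) * emeasure (?k x) A \<partial>P j)"
    proof -
      have "(\<lambda>x. emeasure (?k x) A) \<in> borel_measurable (P j)"
        using measurable_emeasure_kernel[OF kmeas, of A] A by (simp add: G_def sets_P)
      then show ?thesis unfolding G_def by (subst nn_integral_density) simp_all
    qed
    also have "\<dots> = (\<integral>\<^sup>+x. \<integral>\<^sup>+y. ennreal (exp (W m (Suc j) (x(Suc j := y)))) * indicator A (x(Suc j := y)) \<partial>\<mu> (Suc j) \<partial>P j)"
    proof (rule nn_integral_cong)
      fix x assume x: "x \<in> space (P j)"
      have [measurable]: "(\<lambda>y. x(Suc j := y)) \<in> \<mu> (Suc j) \<rightarrow>\<^sub>M P (Suc j)" by (rule measurable_upd_P'[OF x])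
      show "ennreal (exp (W m j x)) * emeasure (?k x) A
        = (\<integral>\<^sup>+y. ennreal (exp (W m (Suc j) (x(Suc j := y)))) * indicator A (x(Suc j := y)) \<partial>\<mu> (Suc j))"
        unfolding k[OF x A]
        by (subst nn_integral_cmult[symmetric])
          (use x in \<open>simp_all add: W_upd[OF x] exp_add ennreal_mult' mult.assoc\<close>)
    qed
    also have "\<dots> = (\<integral>\<^sup>+x. ennreal (exp (W m (Suc j) x)) * indicator A x \<partial>P (Suc j))"
      by (subst nn_integral_P_Suc) simp_all
    also have "\<dots> = emeasure (G m (Suc j)) A"
      unfolding G_def by (simp add: emeasure_density)
    finally show "emeasure (semidirect ?K (Suc j)) A = emeasure (G m (Suc j)) A" .
  qed
qed

lemma G_measure_eq: "m \<in> Delta n \<Longrightarrow> G_measure n \<mu> \<phi> m = G m n"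
  unfolding G_measure_def by (rule semidirect_eq_G) auto

end

section \<open>Duality\<close>

lemma sum_by_parts:
  fixes t a :: "nat \<Rightarrow> real"
  assumes "a 0 = 0"
  shows "(\<Sum>j=1..k. (t j - t (Suc j)) * a j) = (\<Sum>i=1..k. t i * (a i - a (i - 1))) - t (Suc k) * a k"
  using assms by (induction k) (simp_all add: algebra_simps)

locale parisi = cascade +
  fixes \<gamma> :: "nat \<Rightarrow> real"
  assumes gamma_pos: "j \<in> {1..n} \<Longrightarrow> \<gamma> j > 0"
    and gamma_sum: "(\<Sum>k=1..n. \<gamma> k) = 1"
begin

definition \<Gamma> :: "nat \<Rightarrow> real" where
  "\<Gamma> j = (\<Sum>k=1..j. \<gamma> k)"

text \<open>The value 1 beyond \<open>n\<close> turns the boundary term of the summation by parts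
  into \<open>W m n\<close> for \<open>\<phi>\<close> and into \<open>ln 2\<close> for
  \<open>Parisi\<close>.\<close>

definition tinv :: "(nat \<Rightarrow> real) \<Rightarrow> nat \<Rightarrow> real" where
  "tinv m j = (if j \<le> n then 1 / m j else 1)"

text \<open>These differences act as the Lagrange multipliers of the entropy constraints.\<close>

definition gap :: "(nat \<Rightarrow> real) \<Rightarrow> nat \<Rightarrow> real" where
  "gap m j = tinv m j - tinv m (Suc j)"

text \<open>A real-valued form of the entropy of the \<open>j\<close>-th marginal of
  \<open>G m n\<close>; see \<open>rel_entropy_marginal_G\<close>.\<close>

definition ent :: "(nat \<Rightarrow> real) \<Rightarrow> nat \<Rightarrow> real" where
  "ent m j = (\<integral>x. W m j x \<partial>G m n)"

abbreviation \<phi>\<^sub>0 :: "(nat \<Rightarrow> real) \<Rightarrow> real" where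
  "\<phi>\<^sub>0 m \<equiv> \<Phi> m 0 (\<lambda>_. undefined)"

abbreviation Par :: "(nat \<Rightarrow> real) \<Rightarrow> real" where
  "Par m \<equiv> Parisi n \<mu> \<gamma> m \<phi>"

lemma n_pos: "1 \<le> n"
  using gamma_sum by (cases n) auto

lemma Gamma_n: "\<Gamma> n = 1"
  by (simp add: \<Gamma>_def gamma_sum)

lemma gap_nonneg:
  assumes m: "m \<in> Delta n" and j: "1 \<le> j" "j \<le> n"
  shows "0 \<le> gap m j"
proof (cases "j < n")
  case True
  have "m j \<le> m (Suc j)"
    using m True j by (auto simp: Delta_def intro: mono_onD)
  then show ?thesis
    using Delta_pos[OF m, of j] Delta_pos[OF m, of "Suc j"] True j
    by (auto simp: gap_def tinv_def intro!: divide_left_mono)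
next
  case False
  then show ?thesis
    using Delta_pos[OF m, of j] Delta_le1[OF m, of j] j by (auto simp: gap_def tinv_def)
qed

text \<open>In the variables \<open>t = 1 / m\<close>, \<open>Delta\<close> is given by linear
  inequalities (non-increasing, last entry at least 1), so perturbations can be made
  additively.\<close>

lemma Delta_I:
  assumes "\<And>j. 1 \<le> j \<Longrightarrow> j \<le> n \<Longrightarrow> (if j < n then t (Suc j) else 1) \<le> t j"
  shows "(\<lambda>i\<in>{1..n}. 1 / t i) \<in> Delta n"
proof -
  have anti: "t k \<le> t i" if "1 \<le> i" "i \<le> k" "k \<le> n" for i k
    using that(2,3)
  proof (induction rule: dec_induct)
    case (step k)
    have "t (Suc k) \<le> t k" using assms[of k] step that by auto
    then show ?case using step by auto
  qed simp
  have ge1: "1 \<le> t i" if "1 \<le> i" "i \<le> n" for i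
    using anti[OF that(1,2)] assms[OF n_pos] assms[of n] n_pos by auto
  show ?thesis
  proof -
    have "1 / t i \<le> 1 / t k" if "1 \<le> i" "i \<le> k" "k \<le> n" for i k
      using anti[OF that] ge1[of i] ge1[of k] that by (intro divide_left_mono) auto
    moreover have "0 < 1 / t i" "1 / t i \<le> 1" if "1 \<le> i" "i \<le> n" for i
      using ge1[OF that] by auto
    ultimately show ?thesis
      by (auto simp: Delta_def intro!: mono_onI)
  qed
qed

text \<open>Dividing the \<open>i\<close>-th increment of \<open>W\<close> by \<open>m i\<close>
  leaves an increment of the recursion; these telescope to
  \<open>\<phi> x - \<phi>\<^sub>0 m\<close>, and summation by parts brings in the gaps.\<close>

lemma phi_decomposition:
  assumes m: "m \<in> Delta n" and x: "x \<in> space (P n)"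
  shows "\<phi> x = \<phi>\<^sub>0 m + (\<Sum>j=1..n. gap m j * W m j x) + W m n x"
proof -
  let ?f = "\<lambda>i. \<Phi> m i (restrict x {1..i})"
  have "(\<Sum>j=1..n. gap m j * W m j x) = (\<Sum>i=1..n. tinv m i * (W m i x - W m (i - 1) x)) - W m n x"
    unfolding gap_def by (subst sum_by_parts) (simp_all add: tinv_def)
  also have "(\<Sum>i=1..n. tinv m i * (W m i x - W m (i - 1) x)) = (\<Sum>i=1..n. ?f i - ?f (i - 1))"
  proof (rule sum.cong)
    fix i assume i: "i \<in> {1..n}"
    then obtain k where k: "i = Suc k" by (cases i) auto
    have "0 < m i" using i Delta_pos[OF m] by auto
    then show "tinv m i * (W m i x - W m (i - 1) x) = ?f i - ?f (i - 1)"
      using i unfolding k by (simp add: tinv_def W_Suc)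
  qed simp
  also have "\<dots> = ?f n - ?f 0"
    using sum_telescope''[of 0 n ?f] by (simp add: One_nat_def)
  also have "?f n = \<phi> x" using x by (simp add: phi_rec_n restrict_space_P)
  also have "?f 0 = \<phi>\<^sub>0 m" by (simp add: restrict_def)
  finally show ?thesis by simp
qed

text \<open>The same summation by parts with \<open>\<Gamma> j * ln 2\<close> in place of
  \<open>W m j\<close>, so that the two formulas can be compared term by term.\<close>

lemma Parisi_decomposition: "Par m = \<phi>\<^sub>0 m + (\<Sum>j=1..n. gap m j * (\<Gamma> j * ln 2))"
proof -
  have "(\<Sum>j=1..n. gap m j * (\<Gamma> j * ln 2))
    = (\<Sum>i=1..n. tinv m i * (\<Gamma> i * ln 2 - \<Gamma> (i - 1) * ln 2)) - tinv m (Suc n) * (\<Gamma> n * ln 2)"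
    unfolding gap_def by (subst sum_by_parts) (simp_all add: \<Gamma>_def)
  also have "(\<Sum>i=1..n. tinv m i * (\<Gamma> i * ln 2 - \<Gamma> (i - 1) * ln 2)) = (\<Sum>i=1..n. \<gamma> i * ln 2 / m i)"
  proof (rule sum.cong)
    fix i assume i: "i \<in> {1..n}"
    then obtain k where k: "i = Suc k" by (cases i) auto
    show "tinv m i * (\<Gamma> i * ln 2 - \<Gamma> (i - 1) * ln 2) = \<gamma> i * ln 2 / m i"
      using i unfolding k by (simp add: tinv_def \<Gamma>_def field_simps)
  qed simp
  finally show ?thesis by (simp add: Parisi_def Gamma_n tinv_def)
qed

section \<open>Expectations of \<open>W\<close> and entropies of marginals\<close>

lemma marginal_n:
  assumes "sets \<nu> = sets (P n)"
  shows "marginal n \<nu> = \<nu>"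
proof -
  have "marginal n \<nu> = distr \<nu> \<nu> (\<lambda>x. x)"
    unfolding marginal_def
    by (rule distr_cong) (use assms sets_eq_imp_space_eq[OF assms] in \<open>auto simp: sets_P restrict_space_P\<close>)
  then show ?thesis by simp
qed

lemma measurable_restrict_borel_power:
  assumes "sets \<nu> = sets (P n)" "j \<le> n"
  shows "(\<lambda>x. restrict x {1..j}) \<in> \<nu> \<rightarrow>\<^sub>M borel_power j"
  using measurable_restrict_P[OF assms(2)] measurable_cong_sets[OF assms(1) sets_P[of j, symmetric]] by simp

lemma marginal_prob:
  assumes "prob_space \<nu>" "sets \<nu> = sets (P n)" "j \<le> n"
  shows "prob_space (marginal j \<nu>)" "sets (marginal j \<nu>) = sets (P j)"
  using prob_space.prob_space_distr[OF assms(1) measurable_restrict_borel_power[OF assms(2,3)]]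
  by (simp_all add: marginal_def sets_P)

lemma integral_W_marginal:
  assumes "sets \<nu> = sets (P n)" "m \<in> Delta n" "j \<le> k" "k \<le> n"
  shows "(\<integral>x. W m j x \<partial>marginal k \<nu>) = (\<integral>x. W m j x \<partial>\<nu>)"
proof -
  have "W m j \<in> borel_measurable (borel_power k)"
    using W_measurable[OF assms(2,3)] assms measurable_cong_sets[OF sets_P refl] by auto
  then show ?thesis
    unfolding marginal_def
    by (subst integral_distr) (use assms in \<open>simp_all add: measurable_restrict_borel_power W_restrict\<close>)
qed

lemma integrable_W:
  assumes "prob_space \<nu>" "sets \<nu> = sets (P n)" "m \<in> Delta n" "j \<le> n"
  shows "integrable \<nu> (W m j)"
proof -
  interpret nu: prob_space \<nu> by fact
  have "W m j \<in> borel_measurable \<nu>"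
    using W_measurable[OF assms(3,4) assms(4)] assms(2) measurable_cong_sets by blast
  then show ?thesis
    by (intro nu.integrable_const_bound[where B="real n * (2 * B)"])
      (use W_bounded[OF assms(3,4)] in auto)
qed

lemma integral_phi:
  assumes "prob_space \<nu>" "sets \<nu> = sets (P n)" and m: "m \<in> Delta n"
  shows "(\<integral>x. \<phi> x \<partial>\<nu>) = \<phi>\<^sub>0 m + (\<Sum>j=1..n. gap m j * (\<integral>x. W m j x \<partial>\<nu>)) + (\<integral>x. W m n x \<partial>\<nu>)"
proof -
  interpret nu: prob_space \<nu> by fact
  have W: "integrable \<nu> (\<lambda>x. W m j x)" if "j \<le> n" for j
    using integrable_W[OF assms that] .
  have S: "integrable \<nu> (\<lambda>x. \<Sum>j=1..n. gap m j * W m j x)"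
    using W by (intro Bochner_Integration.integrable_sum integrable_mult_right) auto
  have "(\<integral>x. \<phi> x \<partial>\<nu>) = (\<integral>x. \<phi>\<^sub>0 m + (\<Sum>j=1..n. gap m j * W m j x) + W m n x \<partial>\<nu>)"
    by (rule Bochner_Integration.integral_cong)
      (use phi_decomposition[OF m] sets_eq_imp_space_eq[OF assms(2)] in auto)
  also have "\<dots> = \<phi>\<^sub>0 m + (\<Sum>j=1..n. gap m j * (\<integral>x. W m j x \<partial>\<nu>)) + (\<integral>x. W m n x \<partial>\<nu>)"
    using W S by (simp add: nu.prob_space Bochner_Integration.integral_sum)
  finally show ?thesis .
qed

text \<open>The variational bound on the first \<open>j\<close> coordinates with test function
  \<open>W m j\<close>, whose exponential is normalised by
  \<open>nn_integral_exp_W_1\<close>.\<close>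

lemma integral_W_le_rel_entropy:
  assumes nu: "prob_space \<nu>" "sets \<nu> = sets (P n)" and m: "m \<in> Delta n" and j: "j \<le> n"
  shows "ereal (\<integral>x. W m j x \<partial>\<nu>) \<le> rel_entropy (marginal j \<nu>) (P j)"
    and "rel_entropy (marginal j \<nu>) (P j) = ereal (\<integral>x. W m j x \<partial>\<nu>) \<Longrightarrow> marginal j \<nu> = G m j"
proof -
  note var = rel_entropy_variational[OF prob_P marginal_prob[OF nu j] W_measurable[OF m le_refl j]
    W_bounded[OF m j] nn_integral_exp_W_1[OF m j]]
  show "ereal (\<integral>x. W m j x \<partial>\<nu>) \<le> rel_entropy (marginal j \<nu>) (P j)"
    using var(1) by (simp add: integral_W_marginal[OF nu(2) m le_refl j])
  assume "rel_entropy (marginal j \<nu>) (P j) = ereal (\<integral>x. W m j x \<partial>\<nu>)"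
  then show "marginal j \<nu> = G m j"
    unfolding G_def by (intro var(2)) (simp add: integral_W_marginal[OF nu(2) m le_refl j])
qed

lemma ent_eq:
  assumes "m \<in> Delta n" "j \<le> k" "k \<le> n"
  shows "ent m j = (\<integral>x. W m j x \<partial>G m k)"
  using integral_W_marginal[OF sets_G assms(1-3), of m] marginal_G[OF assms(1,3)]
  by (simp add: ent_def)

lemma rel_entropy_marginal_G:
  assumes "m \<in> Delta n" "j \<le> n"
  shows "rel_entropy (marginal j (G m n)) (P j) = ereal (ent m j)"
proof -
  have "rel_entropy (G m j) (P j) = ereal (\<integral>x. W m j x \<partial>G m j)"
    unfolding G_def
    by (rule rel_entropy_density_exp[OF prob_P W_measurable[OF assms(1) le_refl assms(2)] W_bounded[OF assms]])
  then show ?thesis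
    by (simp add: marginal_G[OF assms] ent_eq[OF assms(1) le_refl assms(2)])
qed

lemma integral_W_le_ent:
  assumes "m \<in> Delta n" "m' \<in> Delta n" "j \<le> n"
  shows "(\<integral>x. W m j x \<partial>G m' n) \<le> ent m' j"
  using integral_W_le_rel_entropy(1)[OF prob_G sets_G assms(1,3), of m'] assms
  by (simp add: rel_entropy_marginal_G)

text \<open>A subgradient inequality for \<open>Par\<close> in the gaps, with subgradient
  \<open>\<Gamma> j * ln 2 - ent m' j\<close> at \<open>m'\<close>. The mean of
  \<open>\<phi>\<close> under \<open>G m' n\<close> is expanded once with \<open>m\<close> and once
  with \<open>m'\<close>, and the \<open>W m j\<close> terms are bounded by the entropies.\<close>

lemma Parisi_diff_le:
  assumes m: "m \<in> Delta n" and m': "m' \<in> Delta n"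
  shows "Par m' - Par m \<le> (\<Sum>j=1..n. (gap m' j - gap m j) * (\<Gamma> j * ln 2 - ent m' j))"
proof -
  let ?I = "\<lambda>j. \<integral>x. W m j x \<partial>G m' n"
  note G = prob_G[OF m' le_refl] sets_G[of m' n]
  have "\<phi>\<^sub>0 m' + (\<Sum>j=1..n. gap m' j * ent m' j) + ent m' n
      = \<phi>\<^sub>0 m + (\<Sum>j=1..n. gap m j * ?I j) + ?I n"
    using integral_phi[OF G m] integral_phi[OF G m'] by (simp add: ent_def)
  moreover have "(\<Sum>j=1..n. gap m j * ?I j) \<le> (\<Sum>j=1..n. gap m j * ent m' j)"
    using integral_W_le_ent[OF m m'] gap_nonneg[OF m] by (intro sum_mono mult_left_mono) auto
  moreover have "?I n \<le> ent m' n" using integral_W_le_ent[OF m m'] by simp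
  ultimately have "\<phi>\<^sub>0 m' + (\<Sum>j=1..n. gap m' j * ent m' j) \<le> \<phi>\<^sub>0 m + (\<Sum>j=1..n. gap m j * ent m' j)"
    by linarith
  then show ?thesis
    unfolding Parisi_decomposition by (simp add: algebra_simps sum.distrib sum_subtractf)
qed

section \<open>Weak duality\<close>

abbreviation feasible :: "(nat \<Rightarrow> 'a) measure \<Rightarrow> bool" where
  "feasible \<nu> \<equiv> \<nu> \<in> (\<Inter>j\<in>{1..n}. entropy_ball n \<mu> \<gamma> j)"

lemma feasible_iff:
  "feasible \<nu> \<longleftrightarrow> prob_space \<nu> \<and> sets \<nu> = sets (P n) \<and>
    (\<forall>j\<in>{1..n}. rel_entropy (marginal j \<nu>) (P j) \<le> ereal (\<Gamma> j * ln 2))"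
proof -
  \<comment> \<open>An empty intersection would be the whole type and would not give membership in
    \<open>prob_measures\<close>.\<close>
  have "{1..n} \<noteq> {}" using n_pos by auto
  then have "feasible \<nu> \<longleftrightarrow> prob_space \<nu> \<and> sets \<nu> = sets (P n) \<and>
      (\<forall>j\<in>{1..n}. rel_entropy (marginal j \<nu>) (marginal j (P n)) \<le> ereal (\<Gamma> j * ln 2))"
    unfolding entropy_ball_def prob_measures_def \<Gamma>_def sets_P by blast
  then show ?thesis by (simp add: marginal_P)
qed

text \<open>Termwise comparison of the two decompositions, using non-negative gaps. The remaining
  term, the mean of \<open>W m n\<close> minus the full entropy, is at most 0, and it vanishes only
  for \<open>G m n\<close>.\<close>

lemma Gibbs_le_Parisi:
  assumes nu: "feasible \<nu>" and m: "m \<in> Delta n"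
  shows "Gibbs n \<mu> \<phi> \<nu> \<le> ereal (Par m)"
    and "Gibbs n \<mu> \<phi> \<nu> = ereal (Par m) \<Longrightarrow> \<nu> = G m n"
proof -
  have p: "prob_space \<nu>" and s: "sets \<nu> = sets (P n)"
    using nu unfolding feasible_iff by blast+
  let ?I = "\<lambda>j. \<integral>x. W m j x \<partial>\<nu>"
  \<comment> \<open>Feasibility bounds the entropies above and \<open>W\<close> bounds them below,
    so they are finite and real arithmetic applies.\<close>
  define H where "H j = real_of_ereal (rel_entropy (marginal j \<nu>) (P j))" for j
  have IH: "?I j \<le> H j" and HG: "H j \<le> \<Gamma> j * ln 2" and H: "rel_entropy (marginal j \<nu>) (P j) = ereal (H j)"
    if "j \<in> {1..n}" for j
  proof -
    have 1: "ereal (?I j) \<le> rel_entropy (marginal j \<nu>) (P j)"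
      using integral_W_le_rel_entropy(1)[OF p s m] that by simp
    have 2: "rel_entropy (marginal j \<nu>) (P j) \<le> ereal (\<Gamma> j * ln 2)"
      using nu that unfolding feasible_iff by blast
    show "rel_entropy (marginal j \<nu>) (P j) = ereal (H j)" "?I j \<le> H j" "H j \<le> \<Gamma> j * ln 2"
      using 1 2 unfolding H_def by (cases "rel_entropy (marginal j \<nu>) (P j)"; simp)+
  qed
  have n: "n \<in> {1..n}" using n_pos by simp
  have Gibbs: "Gibbs n \<mu> \<phi> \<nu> = ereal ((\<integral>x. \<phi> x \<partial>\<nu>) - H n)"
    using H[OF n] by (simp add: Gibbs_def marginal_n[OF s])
  have "(\<Sum>j=1..n. gap m j * ?I j) \<le> (\<Sum>j=1..n. gap m j * (\<Gamma> j * ln 2))"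
    using IH HG gap_nonneg[OF m] by (intro sum_mono mult_left_mono) (auto intro: order_trans)
  then have le: "(\<integral>x. \<phi> x \<partial>\<nu>) - H n \<le> Par m + (?I n - H n)"
    unfolding integral_phi[OF p s m] Parisi_decomposition by linarith
  then show "Gibbs n \<mu> \<phi> \<nu> \<le> ereal (Par m)"
    using IH[OF n] Gibbs by simp
  assume "Gibbs n \<mu> \<phi> \<nu> = ereal (Par m)"
  then have "?I n = H n"
    using IH[OF n] Gibbs le by simp
  then have "marginal n \<nu> = G m n"
    using H[OF n] by (intro integral_W_le_rel_entropy(2)[OF p s m le_refl]) simp
  then show "\<nu> = G m n" by (simp add: marginal_n[OF s])
qed

section \<open>Continuity in the parameters\<close>

text \<open>Downward induction with dominated convergence; \<open>exp B\<close> dominates because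
  the parameters are at most 1 and the recursion is bounded by \<open>B\<close>.\<close>

lemma phi_rec_tendsto:
  assumes X: "\<And>k. X k \<in> Delta n" and m: "m \<in> Delta n"
    and lim: "\<And>i. i \<in> {1..n} \<Longrightarrow> (\<lambda>k. X k i) \<longlonglongrightarrow> m i"
    and j: "j \<le> n" and x: "x \<in> space (P j)"
  shows "(\<lambda>k. \<Phi> (X k) j x) \<longlonglongrightarrow> \<Phi> m j x"
  using j x
proof (induction arbitrary: x rule: inc_induct)
  case base
  then show ?case by (simp add: phi_rec_n)
next
  case (step j)
  have j: "Suc j \<le> n" "j < n" using step by auto
  have Xl: "(\<lambda>k. X k (Suc j)) \<longlonglongrightarrow> m (Suc j)" using lim j by simp
  have mpos: "m (Suc j) > 0" using Delta_pos[OF m] j by simp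
  have meas: "(\<lambda>y. \<Phi> m (Suc j) (x(Suc j := y))) \<in> borel_measurable (\<mu> (Suc j))" if "m \<in> Delta n" for m
    using measurable_compose[OF measurable_upd_P'[OF step.prems] phi_rec_measurable[OF that j(1)]] .
  note [measurable] = meas[OF X] meas[OF m]
  have "(\<lambda>k. \<integral>y. exp (X k (Suc j) * \<Phi> (X k) (Suc j) (x(Suc j := y))) \<partial>\<mu> (Suc j))
    \<longlonglongrightarrow> (\<integral>y. exp (m (Suc j) * \<Phi> m (Suc j) (x(Suc j := y))) \<partial>\<mu> (Suc j))"
  proof (rule integral_dominated_convergence[where w="\<lambda>_. exp B"])
    have "(\<lambda>k. \<Phi> (X k) (Suc j) (x(Suc j := y))) \<longlonglongrightarrow> \<Phi> m (Suc j) (x(Suc j := y))" for y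
      by (rule step.IH[OF upd_in_space_P[OF step.prems]])
    then show "AE y in \<mu> (Suc j). (\<lambda>k. exp (X k (Suc j) * \<Phi> (X k) (Suc j) (x(Suc j := y))))
        \<longlonglongrightarrow> exp (m (Suc j) * \<Phi> m (Suc j) (x(Suc j := y)))"
      using Xl by (intro AE_I2 tendsto_intros)
    fix k
    have "X k (Suc j) * \<Phi> (X k) (Suc j) (x(Suc j := y)) \<le> B" for y
    proof -
      have "\<bar>X k (Suc j)\<bar> * \<bar>\<Phi> (X k) (Suc j) (x(Suc j := y))\<bar> \<le> 1 * B"
        using Delta_pos[OF X, of "Suc j" k] Delta_le1[OF X, of "Suc j" k] j
          phi_rec_bounded[OF X j(1) upd_in_space_P[OF step.prems]]
        by (intro mult_mono) auto
      then show ?thesis unfolding abs_mult[symmetric] by linarith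
    qed
    then show "AE y in \<mu> (Suc j). norm (exp (X k (Suc j) * \<Phi> (X k) (Suc j) (x(Suc j := y)))) \<le> exp B"
      by simp
  qed simp_all
  \<comment> \<open>The logarithm is continuous at the limit only if the limit is not 0.\<close>
  moreover have "(\<integral>y. exp (m (Suc j) * \<Phi> m (Suc j) (x(Suc j := y))) \<partial>\<mu> (Suc j)) \<noteq> 0"
  proof -
    have "(\<integral>\<^sup>+y. ennreal (exp (m (Suc j) * \<Phi> m (Suc j) (x(Suc j := y)))) \<partial>\<mu> (Suc j))
        = ennreal (exp (m (Suc j) * \<Phi> m j x))"
      by (rule exp_phi_rec[OF m j(1) step.prems])
    then have "(\<integral>y. exp (m (Suc j) * \<Phi> m (Suc j) (x(Suc j := y))) \<partial>\<mu> (Suc j)) = exp (m (Suc j) * \<Phi> m j x)"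
      by (subst (asm) nn_integral_eq_integrable) auto
    then show ?thesis by simp
  qed
  ultimately show ?case
    unfolding phi_rec_less[OF j(2)] using Xl mpos by (intro tendsto_intros) auto
qed

lemma W_tendsto:
  assumes X: "\<And>k. X k \<in> Delta n" and m: "m \<in> Delta n"
    and lim: "\<And>i. i \<in> {1..n} \<Longrightarrow> (\<lambda>k. X k i) \<longlonglongrightarrow> m i"
    and j: "j \<le> n"
  shows "(\<lambda>k. W (X k) j x) \<longlonglongrightarrow> W m j x"
proof -
  have "(\<lambda>k. \<Phi> (X k) i (restrict x {1..i})) \<longlonglongrightarrow> \<Phi> m i (restrict x {1..i})" if "i \<le> n" for i
    by (rule phi_rec_tendsto[OF X m lim that]) (simp_all add: space_P)
  then show ?thesis
    unfolding W_def using j lim by (intro tendsto_intros) auto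
qed

lemma integral_G:
  assumes m: "m \<in> Delta n" and f: "f \<in> borel_measurable (P n)"
  shows "(\<integral>x. f x \<partial>G m n) = (\<integral>x. exp (W m n x) * f x \<partial>P n)"
  unfolding G_def
  by (subst integral_real_density) (use W_measurable[OF m le_refl le_refl] f in auto)

text \<open>Written as integrals over the fixed measure \<open>P n\<close>, the entropies vary only
  through a uniformly bounded integrand.\<close>

lemma ent_tendsto:
  assumes X: "\<And>k. X k \<in> Delta n" and m: "m \<in> Delta n"
    and lim: "\<And>i. i \<in> {1..n} \<Longrightarrow> (\<lambda>k. X k i) \<longlonglongrightarrow> m i"
    and j: "j \<le> n"
  shows "(\<lambda>k. ent (X k) j) \<longlonglongrightarrow> ent m j"
proof -
  interpret Pn: prob_space "P n" by (rule prob_P)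
  let ?C = "real n * (2 * B)"
  note Wm = W_measurable[OF _ j j] W_measurable[OF _ le_refl le_refl]
  note [measurable] = Wm[OF X] Wm[OF m]
  have "(\<lambda>k. \<integral>x. exp (W (X k) n x) * W (X k) j x \<partial>P n) \<longlonglongrightarrow> (\<integral>x. exp (W m n x) * W m j x \<partial>P n)"
  proof (rule integral_dominated_convergence[where w="\<lambda>_. exp ?C * ?C"])
    show "AE x in P n. (\<lambda>k. exp (W (X k) n x) * W (X k) j x) \<longlonglongrightarrow> exp (W m n x) * W m j x"
      using W_tendsto[OF X m lim] j by (intro AE_I2 tendsto_intros) auto
    fix k
    have "norm (exp (W (X k) n x) * W (X k) j x) \<le> exp ?C * ?C" for x
      using W_bounded[OF X le_refl, of k x] W_bounded[OF X j, of k x]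
      by (auto simp: abs_mult intro!: mult_mono)
    then show "AE x in P n. norm (exp (W (X k) n x) * W (X k) j x) \<le> exp ?C * ?C" by simp
  qed simp_all
  then show ?thesis
    unfolding ent_def by (simp add: integral_G X m Wm)
qed

lemma Parisi_tendsto:
  assumes X: "\<And>k. X k \<in> Delta n" and m: "m \<in> Delta n"
    and lim: "\<And>i. i \<in> {1..n} \<Longrightarrow> (\<lambda>k. X k i) \<longlonglongrightarrow> m i"
  shows "(\<lambda>k. Par (X k)) \<longlonglongrightarrow> Par m"
proof -
  have "m i \<noteq> 0" if "i \<in> {1..n}" for i
    using Delta_pos[OF m, of i] that by auto
  moreover have "(\<lambda>k. \<phi>\<^sub>0 (X k)) \<longlonglongrightarrow> \<phi>\<^sub>0 m"
    by (rule phi_rec_tendsto[OF X m lim]) (simp_all add: space_P)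
  ultimately show ?thesis
    unfolding Parisi_def using lim by (intro tendsto_intros) auto
qed

section \<open>Optimality conditions and uniqueness\<close>

text \<open>The term \<open>\<gamma> 1 * ln 2 / m 1\<close> blows up as \<open>m 1\<close> tends to
  0, so it suffices to minimise over the compact part \<open>m 1 \<ge> \<epsilon>\<close> of
  \<open>Delta n\<close>.\<close>

lemma Parisi_minimizer_exists: "\<exists>m. is_arg_min Par (\<lambda>m. m \<in> Delta n) m"
proof -
  \<comment> \<open>For \<open>m 1 < \<epsilon>\<close> the first summand exceeds
    \<open>2 * B + ln 2\<close>, hence \<open>Par m > B\<close>, while the constant sequence 1 has
    value at most \<open>B\<close>.\<close>
  define \<epsilon> where "\<epsilon> = \<gamma> 1 * ln 2 / (2 * B + ln 2)"
  have g1: "0 < \<gamma> 1" using gamma_pos n_pos by simp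
  have D: "0 < 2 * B + ln (2::real)" using B_nonneg by (simp add: add_nonneg_pos)
  have eps: "0 < \<epsilon>" unfolding \<epsilon>_def using g1 D by simp
  have phi0: "\<bar>\<phi>\<^sub>0 m\<bar> \<le> B" if "m \<in> Delta n" for m
    by (rule phi_rec_bounded[OF that]) (simp_all add: space_P)
  let ?one = "\<lambda>i\<in>{1..n}. 1 :: real"
  have one: "?one \<in> Delta n"
    by (auto simp: Delta_def intro!: mono_onI)
  have Par_one: "Par ?one \<le> B"
  proof -
    have "(\<Sum>i=1..n. \<gamma> i * ln 2 / ?one i) = (\<Sum>i=1..n. \<gamma> i) * ln 2"
      unfolding sum_distrib_right by (intro sum.cong) auto
    then show ?thesis using phi0[OF one] by (simp add: Parisi_def gamma_sum)
  qed
  have small: "\<epsilon> \<le> m 1" if m: "m \<in> Delta n" and le: "Par m \<le> B" for m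
  proof -
    have m1: "0 < m 1" using Delta_pos[OF m] n_pos by simp
    have "\<gamma> 1 * ln 2 / m 1 \<le> (\<Sum>i=1..n. \<gamma> i * ln 2 / m i)"
      using n_pos gamma_pos Delta_pos[OF m]
      by (intro member_le_sum) (auto intro!: divide_nonneg_pos mult_nonneg_nonneg less_imp_le)
    then have "\<gamma> 1 * ln 2 / m 1 \<le> 2 * B + ln 2"
      using le phi0[OF m] by (simp add: Parisi_def)
    then show ?thesis
      unfolding \<epsilon>_def using m1 D by (simp add: field_simps)
  qed
  define K where "K = {m \<in> Delta n. \<epsilon> \<le> m 1}"
  \<comment> \<open>A product over all of \<open>UNIV\<close>, with singletons off
    \<open>{1..n}\<close>, is compact by Tychonoff in the topology of the function type;
    monotonicity is a closed condition there.\<close>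
  have K_eq: "K = (\<Pi>\<^sub>E i\<in>UNIV. if i \<in> {1..n} then {\<epsilon>..1} else {undefined})
      \<inter> {m. \<forall>i\<in>{1..n}. \<forall>k\<in>{1..n}. i \<le> k \<longrightarrow> m i \<le> m k}" (is "_ = ?A \<inter> ?M")
  proof (intro set_eqI iffI)
    fix m assume "m \<in> K"
    then have m: "m \<in> Delta n" "\<epsilon> \<le> m 1" by (auto simp: K_def)
    then have mono: "m i \<le> m k" if "i \<in> {1..n}" "k \<in> {1..n}" "i \<le> k" for i k
      using that m(1) by (auto simp: Delta_def intro: mono_onD)
    have "\<epsilon> \<le> m i" if "i \<in> {1..n}" for i
      using mono[of 1 i] that m(2) by auto
    then show "m \<in> ?A \<inter> ?M"
      using m mono by (auto simp: Delta_def PiE_iff extensional_def)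
  next
    fix m assume m: "m \<in> ?A \<inter> ?M"
    then have b: "i \<in> {1..n} \<Longrightarrow> \<epsilon> \<le> m i \<and> m i \<le> 1" and u: "i \<notin> {1..n} \<Longrightarrow> m i = undefined" for i
      by (auto simp: PiE_iff dest: spec[of _ i])
    have "m \<in> {1..n} \<rightarrow>\<^sub>E {0<..1}"
      using b u eps by (fastforce simp: PiE_iff extensional_def)
    moreover have "mono_on {1..n} m" using m by (auto intro!: mono_onI)
    ultimately show "m \<in> K" using b[of 1] n_pos by (auto simp: K_def Delta_def)
  qed
  have "compact ?A"
    unfolding compactin_euclidean_iff[symmetric] euclidean_product_topology[symmetric]
    by (subst compactin_PiE) auto
  moreover have "closed ?M"
    unfolding Ball_def
    by (intro closed_Collect_all closed_Collect_imp open_Collect_const closed_Collect_le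
        continuous_on_product_coordinates)
  ultimately have "compact K" unfolding K_eq by (rule compact_Int_closed)
  moreover have "continuous_on K Par"
    unfolding continuous_on_sequentially
  proof (intro allI ballI impI, unfold comp_def)
    fix X :: "nat \<Rightarrow> nat \<Rightarrow> real" and m
    assume m: "m \<in> K" and X: "(\<forall>k. X k \<in> K) \<and> X \<longlonglongrightarrow> m"
    have "(\<lambda>k. X k i) \<longlonglongrightarrow> m i" for i
      by (rule continuous_on_tendsto_compose[OF continuous_on_product_coordinates[of i] conjunct2[OF X]]) auto
    then show "(\<lambda>k. Par (X k)) \<longlonglongrightarrow> Par m"
      using m X by (intro Parisi_tendsto) (auto simp: K_def)
  qed
  moreover have eps1: "?one \<in> K"
    using one small[OF one Par_one] by (simp add: K_def)
  ultimately obtain m where m: "m \<in> K" "\<And>m'. m' \<in> K \<Longrightarrow> Par m \<le> Par m'"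
    using continuous_attains_inf[of K Par] by blast
  have "Par m \<le> Par m'" if m': "m' \<in> Delta n" for m'
  proof (cases "Par m' \<le> B")
    case True
    then show ?thesis using small[OF m' True] m' m(2) by (simp add: K_def)
  next
    case False
    then show ?thesis using m(2)[OF eps1] Par_one by linarith
  qed
  then show ?thesis
    using m(1) by (intro exI[of _ m]) (auto simp: is_arg_min_linorder K_def)
qed

text \<open>Adding \<open>\<epsilon>\<close> to \<open>tinv m 1\<close>, ...,
  \<open>tinv m j\<close> changes only the \<open>j\<close>-th gap, and
  \<open>Parisi_diff_le\<close> then fixes the sign of
  \<open>\<epsilon> * (\<Gamma> j * ln 2 - ent (Y \<epsilon>) j)\<close>. Letting
  \<open>\<epsilon>\<close> tend to 0 from above gives the inequality; from below, possible if the
  gap is positive, the equality.\<close>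

lemma minimizer_conditions:
  assumes min: "is_arg_min Par (\<lambda>m. m \<in> Delta n) m" and j: "1 \<le> j" "j \<le> n"
  shows "ent m j \<le> \<Gamma> j * ln 2" and "gap m j > 0 \<Longrightarrow> ent m j = \<Gamma> j * ln 2"
proof -
  have opt: "Par m \<le> Par m'" if "m' \<in> Delta n" for m'
    using min that by (auto simp: is_arg_min_linorder)
  have m: "m \<in> Delta n" using min by (simp add: is_arg_min_def)
  define Y where "Y \<epsilon> = (\<lambda>i\<in>{1..n}. 1 / (tinv m i + (if i \<le> j then \<epsilon> else 0)))" for \<epsilon>
  have tinv_Y: "tinv (Y \<epsilon>) i = tinv m i + (if i \<le> j then \<epsilon> else 0)" if "1 \<le> i" for \<epsilon> i
    using that j by (auto simp: tinv_def Y_def)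
  have gap_Y: "gap (Y \<epsilon>) i - gap m i = (if i = j then \<epsilon> else 0)" if "1 \<le> i" for \<epsilon> i
    using that by (auto simp: gap_def tinv_Y)
  \<comment> \<open>In this range of \<open>\<epsilon>\<close> the only gap that moves stays
    non-negative.\<close>
  have Y_Delta: "Y \<epsilon> \<in> Delta n" if "- gap m j \<le> \<epsilon>" for \<epsilon>
    unfolding Y_def
  proof (rule Delta_I)
    fix i assume i: "1 \<le> i" "i \<le> n"
    have "0 \<le> gap m i" by (rule gap_nonneg[OF m i])
    then have "0 \<le> gap m i + (if i = j then \<epsilon> else 0)" using that by auto
    then show "(if i < n then tinv m (Suc i) + (if Suc i \<le> j then \<epsilon> else 0) else 1)
      \<le> tinv m i + (if i \<le> j then \<epsilon> else 0)"
      using i j by (cases "i = n") (auto simp: gap_def tinv_def split: if_splits)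
  qed
  have key: "0 \<le> \<epsilon> * (\<Gamma> j * ln 2 - ent (Y \<epsilon>) j)" if "- gap m j \<le> \<epsilon>" for \<epsilon>
  proof -
    have "0 \<le> Par (Y \<epsilon>) - Par m" using opt[OF Y_Delta[OF that]] by simp
    also have "\<dots> \<le> (\<Sum>i=1..n. (gap (Y \<epsilon>) i - gap m i) * (\<Gamma> i * ln 2 - ent (Y \<epsilon>) i))"
      by (rule Parisi_diff_le[OF m Y_Delta[OF that]])
    also have "\<dots> = (\<Sum>i=1..n. if i = j then \<epsilon> * (\<Gamma> j * ln 2 - ent (Y \<epsilon>) j) else 0)"
      by (rule sum.cong) (simp_all add: gap_Y)
    also have "\<dots> = \<epsilon> * (\<Gamma> j * ln 2 - ent (Y \<epsilon>) j)" using j by simp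
    finally show ?thesis .
  qed
  \<comment> \<open>Both signs of \<open>s\<close> occur: \<open>s = 1\<close> approaches 0 from
    above, \<open>s = - gap m j\<close> from below.\<close>
  have seq_ge: "- gap m j \<le> s / real (Suc k)" if "- gap m j \<le> s" for s k
  proof (cases "0 \<le> s")
    case False
    then have "s \<le> s / real (Suc k)" by (simp add: le_divide_eq mult_le_cancel_left)
    then show ?thesis using that by linarith
  next
    case True
    then show ?thesis using gap_nonneg[OF m j] by (simp add: order_trans[of _ 0])
  qed
  have lim: "(\<lambda>k. ent (Y (s / real (Suc k))) j) \<longlonglongrightarrow> ent m j" if "- gap m j \<le> s" for s
  proof (rule ent_tendsto[OF Y_Delta m _ j(2)])
    have s0: "(\<lambda>k. s / real (Suc k)) \<longlonglongrightarrow> 0"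
      by (rule LIMSEQ_Suc[OF lim_const_over_n])
    show "- gap m j \<le> s / real (Suc k)" for k
      by (rule seq_ge[OF that])
    fix i assume i: "i \<in> {1..n}"
    have "0 < m i" using Delta_pos[OF m] i by auto
    then have mi: "m i = 1 / (tinv m i + 0)" "tinv m i \<noteq> 0" using i by (auto simp: tinv_def)
    have "(\<lambda>k. if i \<le> j then s / real (Suc k) else 0) \<longlonglongrightarrow> 0"
      using s0 by (cases "i \<le> j") (simp_all only: if_True if_False tendsto_const)
    then have "(\<lambda>k. 1 / (tinv m i + (if i \<le> j then s / real (Suc k) else 0))) \<longlonglongrightarrow> 1 / (tinv m i + 0)"
      by (intro tendsto_divide tendsto_add tendsto_const) (use mi(2) in simp_all)
    then show "(\<lambda>k. Y (s / real (Suc k)) i) \<longlonglongrightarrow> m i"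
      unfolding mi(1)[symmetric] using i by (simp add: Y_def del: of_nat_Suc)
  qed
  show le: "ent m j \<le> \<Gamma> j * ln 2"
  proof (rule LIMSEQ_le_const2[OF lim[of 1]])
    show "- gap m j \<le> 1" using gap_nonneg[OF m j] by simp
    then have "0 \<le> 1 / real (Suc k) * (\<Gamma> j * ln 2 - ent (Y (1 / real (Suc k))) j)" for k
      by (intro key seq_ge)
    then show "\<exists>N. \<forall>k\<ge>N. ent (Y (1 / real (Suc k))) j \<le> \<Gamma> j * ln 2"
      by (simp add: zero_le_mult_iff zero_le_divide_iff)
  qed
  assume g: "gap m j > 0"
  have "\<Gamma> j * ln 2 \<le> ent m j"
  proof (rule LIMSEQ_le_const[OF lim[of "- gap m j"]])
    have "0 \<le> - gap m j / real (Suc k) * (\<Gamma> j * ln 2 - ent (Y (- gap m j / real (Suc k))) j)" for k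
      by (intro key seq_ge) simp
    moreover have "- gap m j / real (Suc k) < 0" for k
      using g by (simp add: divide_neg_pos)
    ultimately have "\<Gamma> j * ln 2 \<le> ent (Y (- gap m j / real (Suc k))) j" for k
      by (metis diff_ge_0_iff_ge linorder_not_le mult_neg_pos less_iff_diff_less_0 neg_0_less_iff_less minus_diff_eq)
    then show "\<exists>N. \<forall>k\<ge>N. \<Gamma> j * ln 2 \<le> ent (Y (- gap m j / real (Suc k))) j"
      by blast
  qed simp
  with le show "ent m j = \<Gamma> j * ln 2" by simp
qed

text \<open>Complementary slackness: for each \<open>j\<close> the gap is 0 or the constraint is
  active, so the two decompositions agree term by term.\<close>

lemma minimizer_G:
  assumes min: "is_arg_min Par (\<lambda>m. m \<in> Delta n) m"
  shows "feasible (G m n)" "Gibbs n \<mu> \<phi> (G m n) = ereal (Par m)"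
proof -
  have m: "m \<in> Delta n" using min by (simp add: is_arg_min_def)
  note cond = minimizer_conditions[OF min]
  show "feasible (G m n)"
    unfolding feasible_iff using prob_G[OF m le_refl] cond(1)
    by (auto simp: rel_entropy_marginal_G[OF m])
  have "(\<Sum>j=1..n. gap m j * ent m j) = (\<Sum>j=1..n. gap m j * (\<Gamma> j * ln 2))"
    using cond(2) gap_nonneg[OF m] by (intro sum.cong) (auto simp: less_le)
  then show "Gibbs n \<mu> \<phi> (G m n) = ereal (Par m)"
    using rel_entropy_marginal_G[OF m le_refl] integral_phi[OF prob_G[OF m le_refl] sets_G m]
    by (simp add: Gibbs_def marginal_n ent_def[symmetric] Parisi_decomposition)
qed

text \<open>The increment of \<open>W\<close> has conditional exponential moment \<open>1\<close>. If it does not depend on the new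
  coordinate, its exponential \<open>u\<close> then has first and second moment \<open>1\<close>, so \<open>u = 1\<close> almost everywhere.\<close>

lemma W_Suc_eq_AE:
  assumes m: "m \<in> Delta n" and j: "Suc j \<le> n" and r[measurable]: "r \<in> borel_measurable (P j)"
    and eq: "AE x in P (Suc j). W m (Suc j) x - W m j x = r (restrict x {1..j})"
  shows "AE x in P (Suc j). W m (Suc j) x = W m j x"
proof -
  have j': "j \<le> n" "j \<le> Suc j" using j by auto
  note [measurable] = W_measurable[OF m le_refl j] W_measurable[OF m le_refl j'(1)]
    measurable_restrict_P[OF j'(2)]
  let ?u = "\<lambda>x. exp (r (restrict x {1..j}))"
  interpret PS: prob_space "P (Suc j)" by (rule prob_P)
  have base: "(\<integral>\<^sup>+x. ennreal (?u x) * h (restrict x {1..j}) \<partial>P (Suc j)) = (\<integral>\<^sup>+x. h x \<partial>P j)"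
    if h[measurable]: "h \<in> borel_measurable (P j)" for h :: "_ \<Rightarrow> ennreal"
  proof -
    \<comment> \<open>The factor \<open>exp (- W m j x)\<close> removes the old density, leaving an
      identity under the product measure.\<close>
    let ?F = "\<lambda>x. ennreal (exp (- W m j x)) * h x"
    have "(\<integral>\<^sup>+x. ennreal (?u x) * h (restrict x {1..j}) \<partial>P (Suc j))
      = (\<integral>\<^sup>+x. ennreal (exp (W m (Suc j) x)) * ?F (restrict x {1..j}) \<partial>P (Suc j))"
    proof (rule nn_integral_cong_AE, use eq in eventually_elim)
      case (elim x)
      have "ennreal (exp (W m (Suc j) x)) * ?F (restrict x {1..j})
        = ennreal (exp (W m (Suc j) x) * exp (- W m j x)) * h (restrict x {1..j})"
        by (simp only: W_restrict[OF le_refl] ennreal_mult' exp_ge_zero mult.assoc)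
      then show ?case by (simp only: exp_add[symmetric] elim[symmetric] diff_conv_add_uminus)
    qed
    also have "\<dots> = (\<integral>\<^sup>+x. ennreal (exp (W m j x)) * ?F x \<partial>P j)"
      by (rule nn_integral_exp_W_Suc[OF m j]) measurable
    also have "\<dots> = (\<integral>\<^sup>+x. h x \<partial>P j)"
      by (rule nn_integral_cong) (simp add: mult.assoc[symmetric] ennreal_mult'[symmetric] exp_minus)
    finally show ?thesis .
  qed
  have u1: "(\<integral>\<^sup>+x. ennreal (?u x) \<partial>P (Suc j)) = 1"
    using base[of "\<lambda>_. 1"] prob_space.emeasure_space_1[OF prob_P, of j] by simp
  have proj: "(\<integral>\<^sup>+x. h (restrict x {1..j}) \<partial>P (Suc j)) = (\<integral>\<^sup>+x. h x \<partial>P j)"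
    if h[measurable]: "h \<in> borel_measurable (P j)" for h :: "_ \<Rightarrow> ennreal"
  proof -
    have "(\<integral>\<^sup>+x. h (restrict x {1..j}) \<partial>P (Suc j)) = (\<integral>\<^sup>+x. \<integral>\<^sup>+y. h (restrict (x(Suc j := y)) {1..j}) \<partial>\<mu> (Suc j) \<partial>P j)"
      by (rule nn_integral_P_Suc) measurable
    also have "\<dots> = (\<integral>\<^sup>+x. h x \<partial>P j)"
      by (rule nn_integral_cong)
        (simp only: restrict_upd_P nn_integral_const prob_space.emeasure_space_1[OF prob_mu] mult_1_right)
    finally show ?thesis .
  qed
  \<comment> \<open>\<open>base\<close> with \<open>h = exp r\<close> absorbs one factor, and
    \<open>proj\<close> identifies the rest with the first moment.\<close>
  have u2: "(\<integral>\<^sup>+x. ennreal (?u x * ?u x) \<partial>P (Suc j)) = 1"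
    using base[of "\<lambda>x. ennreal (exp (r x))"] proj[of "\<lambda>x. ennreal (exp (r x))"] u1
    by (simp add: ennreal_mult'[symmetric])
  have i1: "integrable (P (Suc j)) ?u" "(\<integral>x. ?u x \<partial>P (Suc j)) = 1"
    using nn_integral_eq_integrable[of ?u "P (Suc j)" 1] u1 by auto
  have i2: "integrable (P (Suc j)) (\<lambda>x. ?u x * ?u x)" "(\<integral>x. ?u x * ?u x \<partial>P (Suc j)) = 1"
    using nn_integral_eq_integrable[of "\<lambda>x. ?u x * ?u x" "P (Suc j)" 1] u2 by auto
  let ?g = "\<lambda>x. ?u x * ?u x - 2 * ?u x + 1"
  have gsq: "?g x = (?u x - 1)\<^sup>2" for x by (simp add: power2_eq_square algebra_simps)
  have gi: "integrable (P (Suc j)) ?g" using i1 i2 by simp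
  have "(\<integral>x. ?g x \<partial>P (Suc j)) = 0" using i1 i2 by (simp add: PS.prob_space)
  then have "AE x in P (Suc j). ?g x = 0"
    using integral_nonneg_eq_0_iff_AE[OF gi] by (simp add: gsq)
  with eq show ?thesis
    by eventually_elim (simp add: gsq)
qed

lemma phi_rec_cong_above:
  assumes "\<And>i. j < i \<Longrightarrow> i \<le> n \<Longrightarrow> m i = m' i" "j \<le> n"
  shows "\<Phi> m j x = \<Phi> m' j x"
  using assms(2,1)
proof (induction arbitrary: x rule: inc_induct)
  case base
  show ?case by (simp add: phi_rec_n)
next
  case (step j)
  have "\<Phi> m (Suc j) y = \<Phi> m' (Suc j) y" for y
    by (rule step.IH) (use step.prems in auto)
  moreover have "m (Suc j) = m' (Suc j)" using step by auto
  ultimately show ?case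
    unfolding phi_rec_less[OF step.hyps(2)] by simp
qed

text \<open>Equal measures have equal marginals, whose densities agree almost everywhere; the null
  set is pulled back along the projection from \<open>P k\<close>.\<close>

lemma W_eq_AE_if_G_eq:
  assumes m: "m \<in> Delta n" and m': "m' \<in> Delta n" and eq: "G m n = G m' n"
    and j: "j \<le> k" "k \<le> n"
  shows "AE x in P k. W m j x = W m' j x"
proof -
  have jn: "j \<le> n" using j by simp
  interpret Pj: prob_space "P j" by (rule prob_P)
  note [measurable] = W_measurable[OF m le_refl jn] W_measurable[OF m' le_refl jn]
  have "G m j = G m' j"
    using marginal_G[OF m jn] marginal_G[OF m' jn] eq by simp
  then have "AE x in P j. ennreal (exp (W m j x)) = ennreal (exp (W m' j x))"
    unfolding G_def by (intro Pj.density_unique) auto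
  then have AE: "AE x in P j. W m j x = W m' j x" by simp
  have "AE x in distr (P k) (P j) (\<lambda>x. restrict x {1..j}). W m j x = W m' j x"
  proof (cases "j = 0")
    case True
    then show ?thesis by simp
  next
    case False
    then have "distr (P k) (P j) (\<lambda>x. restrict x {1..j}) = P j"
      by (intro distr_restrict[symmetric]) (use j in auto)
    then show ?thesis using AE by (simp only:)
  qed
  from AE_distrD[OF measurable_restrict_P[OF j(1)] this]
  show ?thesis by (simp add: W_restrict)
qed

text \<open>Both recursions agree at level \<open>Suc j\<close>. Equating the increments of
  \<open>W\<close> and solving, which uses \<open>m (Suc j) \<noteq> m' (Suc j)\<close>, shows that
  this level depends only on the first \<open>j\<close> coordinates. So the entropy does not grow
  from \<open>j\<close> to \<open>Suc j\<close>, the constraint at \<open>Suc j\<close> is slack,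
  and its gap is 0.\<close>

lemma tinv_eq_at_differing_index:
  assumes min: "is_arg_min Par (\<lambda>m. m \<in> Delta n) m" and min': "is_arg_min Par (\<lambda>m. m \<in> Delta n) m'"
    and eq: "G m n = G m' n"
    and j: "Suc j \<le> n" and ne: "m (Suc j) \<noteq> m' (Suc j)"
    and above: "\<And>i. Suc j < i \<Longrightarrow> i \<le> n \<Longrightarrow> m i = m' i"
  shows "tinv m (Suc j) = tinv m (Suc (Suc j))"
proof -
  have m: "m \<in> Delta n" and m': "m' \<in> Delta n" using min min' by (auto simp: is_arg_min_def)
  have j': "j \<le> n" "j \<le> Suc j" using j by auto
  let ?p = "m (Suc j)" and ?p' = "m' (Suc j)"
  let ?a = "\<lambda>x. \<Phi> m (Suc j) (restrict x {1..Suc j})"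
  note [measurable] = phi_rec_measurable[OF m j'(1)] phi_rec_measurable[OF m' j'(1)]
    W_measurable[OF m le_refl j] W_measurable[OF m j'(2,1)]
  \<comment> \<open>The increment of \<open>W\<close> after the solved expression for
    \<open>\<Phi> m (Suc j)\<close> has been inserted.\<close>
  define r where "r y = ?p * ((?p * \<Phi> m j y - ?p' * \<Phi> m' j y) / (?p - ?p') - \<Phi> m j y)" for y
  have r: "r \<in> borel_measurable (P j)" unfolding r_def by measurable
  have same: "\<Phi> m' (Suc j) x = \<Phi> m (Suc j) x" for x
    by (rule phi_rec_cong_above) (use above j in auto)
  have "AE x in P (Suc j). W m (Suc j) x - W m j x = r (restrict x {1..j})"
    using W_eq_AE_if_G_eq[OF m m' eq le_refl j] W_eq_AE_if_G_eq[OF m m' eq j'(2) j]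
  proof eventually_elim
    case (elim x)
    let ?x = "restrict x {1..j}"
    have "?p * (?a x - \<Phi> m j ?x) = ?p' * (?a x - \<Phi> m' j ?x)"
      using elim by (simp add: W_Suc same)
    then have "?a x = (?p * \<Phi> m j ?x - ?p' * \<Phi> m' j ?x) / (?p - ?p')"
      using ne by (simp add: field_simps)
    then show ?case by (simp add: W_Suc r_def)
  qed
  then have AE: "AE x in P (Suc j). W m (Suc j) x = W m j x"
    by (rule W_Suc_eq_AE[OF m j r])
  have "ent m (Suc j) = (\<integral>x. W m (Suc j) x \<partial>G m (Suc j))"
    by (rule ent_eq[OF m le_refl j])
  also have "\<dots> = (\<integral>x. W m j x \<partial>G m (Suc j))"
  proof (rule integral_cong_AE)
    show "AE x in G m (Suc j). W m (Suc j) x = W m j x"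
      unfolding G_def using AE by (subst AE_density) auto
  qed (simp_all add: G_def)
  also have "\<dots> = ent m j" by (rule ent_eq[OF m j'(2) j, symmetric])
  also have "\<dots> \<le> \<Gamma> j * ln 2"
  \<comment> \<open>The optimality conditions start at index 1; at index 0 both sides are 0.\<close>
  proof (cases j)
    case 0
    then show ?thesis by (simp add: ent_def \<Gamma>_def)
  next
    case (Suc i)
    then show ?thesis using minimizer_conditions(1)[OF min, of j] j by simp
  qed
  also have "\<dots> < \<Gamma> (Suc j) * ln 2"
    using gamma_pos[of "Suc j"] j by (simp add: \<Gamma>_def)
  finally have "\<not> gap m (Suc j) > 0"
    using minimizer_conditions(2)[OF min, of "Suc j"] j by auto
  then show ?thesis
    using gap_nonneg[OF m, of "Suc j"] j by (simp add: gap_def)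
qed

text \<open>The equality case of weak duality gives both minimisers the same \<open>G\<close>. At
  the largest index where they differ, each \<open>tinv\<close> equals its successor, and the
  successors coincide.\<close>

lemma minimizer_unique:
  assumes min: "is_arg_min Par (\<lambda>m. m \<in> Delta n) m" and min': "is_arg_min Par (\<lambda>m. m \<in> Delta n) m'"
  shows "m = m'"
proof (rule ccontr)
  assume "m \<noteq> m'"
  have m: "m \<in> Delta n" and m': "m' \<in> Delta n" using min min' by (auto simp: is_arg_min_def)
  have "Par m = Par m'" using min min' by (auto simp: is_arg_min_linorder intro: antisym)
  then have G: "G m n = G m' n"
    using Gibbs_le_Parisi(2)[OF minimizer_G(1)[OF min] m'] minimizer_G(2)[OF min] by simp
  define D where "D = {i \<in> {1..n}. m i \<noteq> m' i}"
  have "D \<noteq> {}"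
  proof
    assume "D = {}"
    then have "m i = m' i" if "i \<in> {1..n}" for i using that by (auto simp: D_def)
    then have "m = m'" using m m' by (intro PiE_ext[of m "{1..n}" "\<lambda>_. {0<..1}"]) (auto simp: Delta_def)
    with \<open>m \<noteq> m'\<close> show False ..
  qed
  moreover have fin: "finite D" by (simp add: D_def)
  ultimately have M: "Max D \<in> D" by simp
  then obtain j where j: "Max D = Suc j" by (cases "Max D") (auto simp: D_def)
  have jn: "Suc j \<le> n" and ne: "m (Suc j) \<noteq> m' (Suc j)" using M j by (auto simp: D_def)
  have above: "m i = m' i" if "Suc j < i" "i \<le> n" for i
  proof (rule ccontr)
    assume "m i \<noteq> m' i"
    then have "i \<in> D" using that by (simp add: D_def)
    from Max_ge[OF fin this] show False using that j by simp
  qed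
  have "tinv m (Suc j) = tinv m (Suc (Suc j))"
    by (rule tinv_eq_at_differing_index[OF min min' G jn ne above])
  \<comment> \<open>If \<open>Suc j = n\<close>, both sides are 1 by the convention in
    \<open>tinv\<close>.\<close>
  also have "\<dots> = tinv m' (Suc (Suc j))"
    using above[of "Suc (Suc j)"] by (simp add: tinv_def)
  also have "\<dots> = tinv m' (Suc j)"
    by (rule tinv_eq_at_differing_index[OF min' min G[symmetric] jn ne[symmetric] above[symmetric], symmetric])
  finally show False using jn ne by (simp add: tinv_def)
qed

lemma is_arg_max_iff_G:
  assumes min: "is_arg_min Par (\<lambda>m. m \<in> Delta n) m"
  shows "is_arg_max (Gibbs n \<mu> \<phi>) (\<lambda>\<nu>. feasible \<nu>) \<nu> \<longleftrightarrow> \<nu> = G m n"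
proof -
  have m: "m \<in> Delta n" using min by (simp add: is_arg_min_def)
  note G = minimizer_G[OF min] and ub = Gibbs_le_Parisi[OF _ m]
  show ?thesis
  proof
    assume "is_arg_max (Gibbs n \<mu> \<phi>) (\<lambda>\<nu>. feasible \<nu>) \<nu>"
    then have "feasible \<nu>" "Gibbs n \<mu> \<phi> (G m n) \<le> Gibbs n \<mu> \<phi> \<nu>"
      using G(1) unfolding is_arg_max_linorder by blast+
    then show "\<nu> = G m n"
      using ub[of \<nu>] G(2) by (metis antisym)
  next
    assume "\<nu> = G m n"
    then show "is_arg_max (Gibbs n \<mu> \<phi>) (\<lambda>\<nu>. feasible \<nu>) \<nu>"
      using G ub(1) unfolding is_arg_max_linorder by simp
  qed
qed

lemma parisi_variational_principle:
  "(\<exists>!\<nu>. is_arg_max (Gibbs n \<mu> \<phi>) (\<lambda>\<nu>. feasible \<nu>) \<nu>)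
    \<and> (\<exists>!m. is_arg_min Par (\<lambda>m. m \<in> Delta n) m)
    \<and> (\<forall>m. is_arg_min Par (\<lambda>m. m \<in> Delta n) m \<longrightarrow>
          is_arg_max (Gibbs n \<mu> \<phi>) (\<lambda>\<nu>. feasible \<nu>) (G_measure n \<mu> \<phi> m)
        \<and> Gibbs n \<mu> \<phi> (G_measure n \<mu> \<phi> m) = ereal (Par m))"
proof -
  obtain m where m: "is_arg_min Par (\<lambda>m. m \<in> Delta n) m"
    using Parisi_minimizer_exists by blast
  have "G_measure n \<mu> \<phi> m' = G m' n" if "is_arg_min Par (\<lambda>m. m \<in> Delta n) m'" for m'
    using that by (intro G_measure_eq) (simp add: is_arg_min_def)
  then show ?thesis
    using m minimizer_unique minimizer_G(2) is_arg_max_iff_G by auto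
qed

end

section \<open>Reduction to measures given on all coordinates\<close>

text \<open>Composition with the restriction to \<open>I\<close> extends \<open>f\<close>
  continuously to all functions, where the Borel and product sigma-algebras agree since the index
  type is countable and the space second countable.\<close>

lemma continuous_map_imp_measurable_PiM:
  fixes f :: "('i::countable \<Rightarrow> 'a::second_countable_topology) \<Rightarrow> real"
  assumes f: "continuous_map (product_topology (\<lambda>_. euclidean) I) euclidean f"
    and M: "\<And>i. i \<in> I \<Longrightarrow> sets (M i) = sets borel"
  shows "f \<in> borel_measurable (Pi\<^sub>M I M)"
proof -
  have "continuous_map (product_topology (\<lambda>_. euclidean) UNIV)
      (product_topology (\<lambda>_. euclidean :: 'a topology) I) (\<lambda>x. restrict x I)"
    by (auto simp: continuous_map_componentwise intro: continuous_map_product_projection)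
  from continuous_map_compose[OF this f] have "continuous_on UNIV (\<lambda>x. f (restrict x I))"
    by (simp add: euclidean_product_topology comp_def)
  then have "(\<lambda>x. f (restrict x I)) \<in> borel_measurable (Pi\<^sub>M UNIV (\<lambda>_. borel))"
    using borel_measurable_continuous_onI measurable_cong_sets[OF sets_PiM_equal_borel refl] by blast
  \<comment> \<open>Coordinates outside \<open>I\<close> are constantly \<open>undefined\<close> on
    the extensional functions, hence measurable.\<close>
  moreover have "(\<lambda>x. x) \<in> Pi\<^sub>M I M \<rightarrow>\<^sub>M Pi\<^sub>M UNIV (\<lambda>_. borel)"
  proof (rule measurable_PiM_single')
    fix i
    show "(\<lambda>x. x i) \<in> Pi\<^sub>M I M \<rightarrow>\<^sub>M borel"
    proof (cases "i \<in> I")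
      case True
      then show ?thesis
        using measurable_component_singleton[of i I M] measurable_cong_sets[OF refl M[OF True]] by blast
    next
      case False
      then have "(\<lambda>x. x i) \<in> Pi\<^sub>M I M \<rightarrow>\<^sub>M borel \<longleftrightarrow> (\<lambda>_. undefined) \<in> Pi\<^sub>M I M \<rightarrow>\<^sub>M (borel :: 'a measure)"
        by (intro measurable_cong) (auto simp: space_PiM PiE_iff extensional_def)
      then show ?thesis by simp
    qed
  qed auto
  ultimately have "(\<lambda>x. f (restrict x I)) \<in> borel_measurable (Pi\<^sub>M I M)"
    by (rule measurable_compose[rotated])
  then show ?thesis
    by (rule measurable_cong[THEN iffD1, rotated]) (auto simp: space_PiM PiE_iff extensional_restrict)
qed

lemma phi_rec_cong_measures:
  assumes "\<And>i. i \<in> {1..n} \<Longrightarrow> \<mu> i = \<mu>' i"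
  shows "phi_rec n \<mu> m \<phi> j x = phi_rec n \<mu>' m \<phi> j x"
proof (induction "n - j" arbitrary: j x)
  case 0
  then have "n \<le> j" by simp
  then show ?case by (subst (1 2) phi_rec.simps) (simp only: if_True)
next
  case (Suc k)
  then have j: "\<not> n \<le> j" and IH: "\<And>x. phi_rec n \<mu> m \<phi> (Suc j) x = phi_rec n \<mu>' m \<phi> (Suc j) x"
    by auto
  moreover have "\<mu> (Suc j) = \<mu>' (Suc j)" using j by (intro assms) auto
  ultimately show ?case
    by (subst phi_rec.simps, subst (2) phi_rec.simps) (simp only: if_False)
qed

lemma semidirect_cong:
  assumes "\<And>i. i \<in> {1..j} \<Longrightarrow> K i = K' i"
  shows "semidirect K j = semidirect K' j"
  using assms by (induction j) auto

text \<open>Allows the measures outside \<open>{1..n}\<close> to be replaced by probability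
  measures.\<close>

lemma Gibbs_cong_measures:
  assumes "\<And>i. i \<in> {1..n} \<Longrightarrow> \<mu> i = \<mu>' i"
  shows "Gibbs n \<mu> \<phi> = Gibbs n \<mu>' \<phi>" "entropy_ball n \<mu> \<gamma> j = entropy_ball n \<mu>' \<gamma> j"
    "Parisi n \<mu> \<gamma> m \<phi> = Parisi n \<mu>' \<gamma> m \<phi>" "G_measure n \<mu> \<phi> m = G_measure n \<mu>' \<phi> m"
proof -
  have "Pi\<^sub>M {1..n} \<mu> = Pi\<^sub>M {1..n} \<mu>'" using assms by (intro PiM_cong) auto
  then show "Gibbs n \<mu> \<phi> = Gibbs n \<mu>' \<phi>" "entropy_ball n \<mu> \<gamma> j = entropy_ball n \<mu>' \<gamma> j"
    by (simp_all add: Gibbs_def fun_eq_iff entropy_ball_def)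
  have phi: "phi_rec n \<mu> m \<phi> i x = phi_rec n \<mu>' m \<phi> i x" for i x
    by (rule phi_rec_cong_measures) (rule assms)
  show "Parisi n \<mu> \<gamma> m \<phi> = Parisi n \<mu>' \<gamma> m \<phi>" by (simp add: Parisi_def phi)
  show "G_measure n \<mu> \<phi> m = G_measure n \<mu>' \<phi> m"
    unfolding G_measure_def
    by (intro semidirect_cong ext) (simp add: K_kernel_def phi assms)
qed

theorem proposition3p6:
  fixes n :: nat
    and \<mu> :: "nat \<Rightarrow> 'a::polish_space measure"
    and \<gamma> :: "nat \<Rightarrow> real"
    and \<phi> :: "(nat \<Rightarrow> 'a) \<Rightarrow> real"
  assumes "\<And>j. j \<in> {1..n} \<Longrightarrow> prob_space (\<mu> j)"
    and "\<And>j. j \<in> {1..n} \<Longrightarrow> sets (\<mu> j) = sets borel"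
    and "\<And>j. j \<in> {1..n} \<Longrightarrow> \<gamma> j > 0"
    and "(\<Sum>k=1..n. \<gamma> k) = 1"
    and "continuous_map (product_topology (\<lambda>_. euclidean) {1..n}) euclidean \<phi>"
    and "bounded (\<phi> ` ({1..n} \<rightarrow>\<^sub>E UNIV))"
  shows "(\<exists>!\<nu>. is_arg_max (Gibbs n \<mu> \<phi>) (\<lambda>\<nu>. \<nu> \<in> (\<Inter>j\<in>{1..n}. entropy_ball n \<mu> \<gamma> j)) \<nu>)
    \<and> (\<exists>!m. is_arg_min (\<lambda>m. Parisi n \<mu> \<gamma> m \<phi>) (\<lambda>m. m \<in> Delta n) m)
    \<and> (\<forall>m. is_arg_min (\<lambda>m. Parisi n \<mu> \<gamma> m \<phi>) (\<lambda>m. m \<in> Delta n) m \<longrightarrow>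
          is_arg_max (Gibbs n \<mu> \<phi>) (\<lambda>\<nu>. \<nu> \<in> (\<Inter>j\<in>{1..n}. entropy_ball n \<mu> \<gamma> j)) (G_measure n \<mu> \<phi> m)
        \<and> Gibbs n \<mu> \<phi> (G_measure n \<mu> \<phi> m) = ereal (Parisi n \<mu> \<gamma> m \<phi>))"
proof -
  \<comment> \<open>A point mass fills the indices outside \<open>{1..n}\<close>, as the locale asks
    for a Borel probability measure at every index.\<close>
  define \<mu>' where "\<mu>' i = (if i \<in> {1..n} then \<mu> i else return borel undefined)" for i
  have eq: "\<mu> i = \<mu>' i" if "i \<in> {1..n}" for i using that by (simp add: \<mu>'_def)
  have prob: "prob_space (\<mu>' i)" and sets: "sets (\<mu>' i) = sets borel" for i
    using assms(1,2) by (auto simp: \<mu>'_def intro: prob_space_return)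
  obtain B where B: "\<And>x. x \<in> {1..n} \<rightarrow>\<^sub>E UNIV \<Longrightarrow> \<bar>\<phi> x\<bar> \<le> B"
    using assms(6) unfolding bounded_iff by auto
  interpret parisi n \<mu>' \<phi> B \<gamma>
  proof (intro parisi.intro cascade.intro parisi_axioms.intro)
    show "\<phi> \<in> borel_measurable (Pi\<^sub>M {1..n} \<mu>')"
      by (rule continuous_map_imp_measurable_PiM[OF assms(5) sets])
    show "\<bar>\<phi> x\<bar> \<le> B" if "x \<in> space (Pi\<^sub>M {1..n} \<mu>')" for x
    proof (rule B)
      show "x \<in> {1..n} \<rightarrow>\<^sub>E UNIV"
        using that sets_eq_imp_space_eq[OF sets] by (simp add: space_PiM)
    qed
  qed (fact prob sets assms(3) assms(4))+
  have cong: "Gibbs n \<mu> \<phi> = Gibbs n \<mu>' \<phi>" "entropy_ball n \<mu> \<gamma> j = entropy_ball n \<mu>' \<gamma> j"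
    "Parisi n \<mu> \<gamma> m \<phi> = Parisi n \<mu>' \<gamma> m \<phi>" "G_measure n \<mu> \<phi> m = G_measure n \<mu>' \<phi> m" for j m
    by (rule Gibbs_cong_measures, rule eq, assumption)+
  show ?thesis
    unfolding cong by (rule parisi_variational_principle)
qed

end
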